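(* Let $\rho:\mathbb{R}\to\mathbb{R}$ be a non-affine continuous function that is continuously differentiable at some point $c\in\mathbb{R}$ with $\rho'(c)\neq0$. Let $n,m\ge1$, let $\mathcal{K}\subset\mathbb{R}^n$ be compact, let $N=n+m+2$, and let $r\ge1$ be an integer. Then the class of Wide DLoR networks with activation $\rho$, i.e. networks constructed from parallel DLoR components of rank $r$ forming expanded layers of width $L\times N$ (with $L$ arbitrary), is dense in $C(\mathcal{K},\mathbb{R}^m)$ with respect to the uniform norm.
   Context: $\rho$ is applied entrywise to vectors and $\mathbf{1}_N\in\mathbb{R}^N$ is the vector of ones. "Continuously differentiable at $c$" means that $\rho$ is differentiable in a neighbourhood of $c$ and $\rho'$ is continuous at $c$. $C(\mathcal{K},\mathbb{R}^m)$ is the space of continuous functions $\mathcal{K}\to\mathbb{R}^m$ with norm $\|f\|_\infty=\sup_{x\in\mathcal{K}}\|f(x)\|_2$. A Diagonal plus Low-Rank (DLoR) component of rank $r$ is a matrix $M=\alpha I_N+UV^T\in\mathbb{R}^{N\times N}$ with $\alpha\in\mathbb{R}$ and $U,V\in\mathbb{R}^{N\times r}$. A parallel DLoR block is a map $\mathbb{R}^N\to\mathbb{R}^N$ of the form $$\mathcal{B}(z)=\rho\Big(\sum_{l=1}^{L}\frac{\beta_l}{h\rho'(c)}\,\rho\big(\tfrac{h}{\beta_l}M_lz+c\,\mathbf{1}_N\big)+b\Big),$$ where $L\ge2$, $h>0$, $\beta_1,\dots,\beta_L$ are non-zero reals with $\sum_l\beta_l=0$, each $M_l$ is a DLoR component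 of rank $r$, and $b\in\mathbb{R}^N$; its inner layer, obtained by stacking the $L$ parallel components, has width $L\times N$. A Wide DLoR network is a map $x\mapsto A(\mathcal{B}_T\circ\cdots\circ\mathcal{B}_1)(\tilde x)+a$ with $T\ge 1$ arbitrary, $\mathcal{B}_t$ parallel DLoR blocks, $\tilde x=(x,0)\in\mathbb{R}^N$ the zero-padded input, $A\in\mathbb{R}^{m\times N}$ and $a\in\mathbb{R}^m$. *)

theory Defs
  imports "HOL-Analysis.Analysis"
begin

definition affine_fun :: "(real \<Rightarrow> real) \<Rightarrow> bool" where
  "affine_fun \<rho> \<longleftrightarrow> (\<exists>a b. \<forall>x. \<rho> x = a * x + b)"

definition cont_diff_at :: "(real \<Rightarrow> real) \<Rightarrow> real \<Rightarrow> bool" where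
  "cont_diff_at \<rho> c \<longleftrightarrow>
     (\<forall>\<^sub>F x in nhds c. \<rho> differentiable (at x)) \<and> isCont (deriv \<rho>) c"

definition entrywise :: "(real \<Rightarrow> real) \<Rightarrow> real ^ 'k \<Rightarrow> real ^ 'k" where
  "entrywise \<rho> z = (\<chi> i. \<rho> (z $ i))"

text \<open>The rank \<open>r\<close> is the cardinality of the index type \<open>'r\<close>, passed as \<open>TYPE('r)\<close>.
  It is the number of columns of \<open>U\<close> and \<open>V\<close>, which need not be linearly independent.\<close>

definition dlor_component :: "'r::finite itself \<Rightarrow> real ^ 'k ^ 'k \<Rightarrow> bool" where
  "dlor_component _ M \<longleftrightarrow>
     (\<exists>(\<alpha>::real) (U :: real ^ 'r ^ 'k) (V :: real ^ 'r ^ 'k).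
        M = \<alpha> *\<^sub>R mat 1 + U ** transpose V)"

text \<open>Components \<open>l = 1, \<dots>, L\<close> are indexed by \<open>l < L\<close>; \<open>vec 1\<close> is the vector of ones.\<close>

definition parallel_block ::
  "(real \<Rightarrow> real) \<Rightarrow> real \<Rightarrow> nat \<Rightarrow> real \<Rightarrow> (nat \<Rightarrow> real) \<Rightarrow> (nat \<Rightarrow> real ^ 'k ^ 'k) \<Rightarrow>
     real ^ 'k \<Rightarrow> real ^ 'k \<Rightarrow> real ^ 'k" where
  "parallel_block \<rho> c L h \<beta> M b z =
     entrywise \<rho>
       ((\<Sum>l<L. (\<beta> l / (h * deriv \<rho> c)) *\<^sub>R
            entrywise \<rho> ((h / \<beta> l) *\<^sub>R (M l *v z) + c *\<^sub>R vec 1)) + b)"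

definition parallel_dlor_block ::
  "'r::finite itself \<Rightarrow> (real \<Rightarrow> real) \<Rightarrow> real \<Rightarrow> (real ^ 'k \<Rightarrow> real ^ 'k) \<Rightarrow> bool" where
  "parallel_dlor_block R \<rho> c B \<longleftrightarrow>
     (\<exists>L h \<beta> M b. 2 \<le> L \<and> 0 < h \<and> (\<forall>l<L. \<beta> l \<noteq> 0) \<and> (\<Sum>l<L. \<beta> l) = 0 \<and>
        (\<forall>l<L. dlor_component R (M l)) \<and> B = parallel_block \<rho> c L h \<beta> M b)"

definition zero_pad :: "real ^ 'n::finite \<Rightarrow> real ^ ('n + 'k::finite)" where
  "zero_pad x = (\<chi> i. case i of Inl j \<Rightarrow> x $ j | Inr _ \<Rightarrow> 0)"

text \<open>The index type \<open>'n + 'm + 2\<close> of the hidden space has \<open>CARD('n) + CARD('m) + 2\<close>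
  elements. The head of the list \<open>Bs\<close> is the block that is applied first.\<close>

definition wide_dlor_network ::
  "'r::finite itself \<Rightarrow> (real \<Rightarrow> real) \<Rightarrow> real \<Rightarrow> (real ^ 'n::finite \<Rightarrow> real ^ 'm::finite) \<Rightarrow> bool" where
  "wide_dlor_network R \<rho> c g \<longleftrightarrow>
     (\<exists>(Bs :: (real ^ ('n + 'm + 2) \<Rightarrow> real ^ ('n + 'm + 2)) list)
        (A :: real ^ ('n + 'm + 2) ^ 'm) (a :: real ^ 'm).
        Bs \<noteq> [] \<and> (\<forall>B \<in> set Bs. parallel_dlor_block R \<rho> c B) \<and>
        g = (\<lambda>x. A *v fold (\<lambda>B z. B z) Bs (zero_pad x) + a))"

end

theory Submission
  imports Defs
begin

text \<open>A matrix of rank one can feed a linear form into a single coordinate, and two components with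
  zero matrix absorb the condition \<open>\<Sum>l. \<beta> l = 0\<close>. Hence a block is \<open>\<rho>\<close> applied to a state whose
  coordinates are arbitrary independent shallow networks, the biases coming from one coordinate
  kept constant. Shallow networks approximate the square function, because integrating \<open>\<rho>\<close> twice
  over short intervals gives a smooth function with non-zero second derivative somewhere; so one
  block can multiply coordinates. The outer \<open>\<rho>\<close> is harmless: values are stored near \<open>c\<close>, where
  \<open>\<rho>\<close> is almost linear. The \<open>n\<close> inputs, \<open>m\<close> accumulators, one working register and the constant
  then suffice to evaluate any polynomial map monomial by monomial, and Stone--Weierstrass
  applies.\<close>

section \<open>Uniform closures\<close>

text \<open>The format of a block is the obstacle: its inner bias is pinned to \<open>c\<close>, its
  outer \<open>\<rho>\<close> cannot be switched off, and nothing beyond a first derivative is known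
  at \<open>c\<close>. Curvature has to be found elsewhere, and a bias leading there is a weight on
  a coordinate storing a non-zero value of \<open>\<rho>\<close>; such a value exists because the
  zero function is affine. The raw input has no such coordinate, but there the bias \<open>c\<close>
  is exactly the right one. Error propagation through the depth is never estimated. Blocks are
  continuous and \<open>K\<close> is compact, so a uniform limit of reachable states may be treated
  as reachable itself. A state counts as available only if it can be stored at every scale
  \<open>e\<close>: the scale at which it is read then tends to 0 while the scale at which the next
  state is written stays fixed.\<close>

definition uclosure :: "'a set \<Rightarrow> ('a \<Rightarrow> 'b::metric_space) set \<Rightarrow> ('a \<Rightarrow> 'b) set" where
  "uclosure K S = {g. \<forall>e>0. \<exists>s\<in>S. \<forall>x\<in>K. dist (s x) (g x) < e}"

lemma uclosureI:
  assumes "\<And>e. e > 0 \<Longrightarrow> \<exists>s\<in>S. \<forall>x\<in>K. dist (s x) (g x) < e"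
  shows "g \<in> uclosure K S"
  using assms by (simp add: uclosure_def)

lemma uclosureD:
  assumes "g \<in> uclosure K S" and "e > 0"
  obtains s where "s \<in> S" and "\<And>x. x \<in> K \<Longrightarrow> dist (s x) (g x) < e"
  using assms unfolding uclosure_def by blast

lemma subset_uclosure: "g \<in> S \<Longrightarrow> g \<in> uclosure K S"
  by (auto simp: uclosure_def intro!: bexI[of _ g])

text \<open>The filter is arbitrary because limits are taken both along sequences and for a scale
  tending to 0 from the right.\<close>

lemma uclosure_limit:
  assumes "uniform_limit K G g F" and "\<forall>\<^sub>F k in F. G k \<in> uclosure K S" and "F \<noteq> bot"
  shows "g \<in> uclosure K S"
proof (rule uclosureI)
  fix e :: real assume "e > 0"
  then have "e / 2 > 0" by simp
  from uniform_limitD[OF assms(1) this] assms(2)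
  have "\<forall>\<^sub>F k in F. G k \<in> uclosure K S \<and> (\<forall>x\<in>K. dist (G k x) (g x) < e / 2)"
    by eventually_elim simp
  from eventually_happens'[OF assms(3) this] obtain k
    where k: "G k \<in> uclosure K S" "\<forall>x\<in>K. dist (G k x) (g x) < e / 2" by blast
  obtain s where "s \<in> S" "\<And>x. x \<in> K \<Longrightarrow> dist (s x) (G k x) < e / 2"
    using uclosureD[OF k(1) \<open>e / 2 > 0\<close>] by blast
  note s = this
  have "dist (s x) (g x) < e" if "x \<in> K" for x
    using s(2)[OF that] k(2) that dist_triangle_half_r[of "G k x" "s x" e "g x"]
    by (simp add: dist_commute)
  with s(1) show "\<exists>s\<in>S. \<forall>x\<in>K. dist (s x) (g x) < e"
    by blast
qed

lemma uclosure_sequence: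
  assumes "g \<in> uclosure K S"
  obtains s where "\<And>n::nat. s n \<in> S" and "uniform_limit K s g sequentially"
proof -
  have "\<exists>s\<in>S. \<forall>x\<in>K. dist (s x) (g x) < inverse (real (Suc n))" for n
    using assms unfolding uclosure_def by simp
  then obtain s where s: "\<And>n. s n \<in> S"
      "\<And>n x. x \<in> K \<Longrightarrow> dist (s n x) (g x) < inverse (real (Suc n))"
    by metis
  have "uniform_limit K s g sequentially"
  proof (rule uniform_limitI)
    fix e :: real assume "e > 0"
    have "\<forall>\<^sub>F n in sequentially. inverse (real (Suc n)) < e"
      using order_tendstoD(2)[OF LIMSEQ_inverse_real_of_nat \<open>e > 0\<close>] .
    then show "\<forall>\<^sub>F n in sequentially. \<forall>x\<in>K. dist (s n x) (g x) < e"
      by eventually_elim (use s(2) less_trans in blast)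
  qed
  with s(1) that show ?thesis by blast
qed

lemma uclosure_trans:
  assumes "g \<in> uclosure K S" and "\<And>s. s \<in> S \<Longrightarrow> s \<in> uclosure K S'"
  shows "g \<in> uclosure K S'"
proof -
  obtain s where "\<And>n::nat. s n \<in> S" "uniform_limit K s g sequentially"
    using uclosure_sequence[OF assms(1)] by blast
  note s = this
  show ?thesis
    by (rule uclosure_limit[OF s(2)]) (simp_all add: assms(2) s(1))
qed

lemma uclosure_compose:
  assumes "g \<in> uclosure K S" and "h ` K' \<subseteq> K" and "\<And>s. s \<in> S \<Longrightarrow> (\<lambda>x. s (h x)) \<in> S'"
  shows "(\<lambda>x. g (h x)) \<in> uclosure K' S'"
proof (rule uclosureI)
  fix e :: real assume "e > 0"
  then obtain s where "s \<in> S" "\<And>x. x \<in> K \<Longrightarrow> dist (s x) (g x) < e"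
    using uclosureD[OF assms(1)] by blast
  then show "\<exists>s\<in>S'. \<forall>x\<in>K'. dist (s x) (g (h x)) < e"
    using assms(2,3) by (intro bexI[of _ "\<lambda>x. s (h x)"]) auto
qed

lemma uclosure_continuous_on:
  assumes "g \<in> uclosure K S" and "\<And>s. s \<in> S \<Longrightarrow> continuous_on K s"
  shows "continuous_on K g"
proof -
  obtain s where "\<And>n::nat. s n \<in> S" "uniform_limit K s g sequentially"
    using uclosure_sequence[OF assms(1)] by blast
  note s = this
  show ?thesis
    by (rule uniform_limit_theorem[OF _ s(2)]) (simp_all add: assms(2) s(1))
qed

text \<open>Eventually all \<open>G k\<close> map \<open>K\<close> into one ball slightly larger
  than the bounded image of \<open>g\<close>; that ball is compact, so \<open>\<phi>\<close> is
  uniformly continuous on it.\<close>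

lemma uniform_limit_continuous_compose:
  fixes \<phi> :: "'b::heine_borel \<Rightarrow> 'c::metric_space"
  assumes lim: "uniform_limit K G g F" and "bounded (g ` K)" and "continuous_on UNIV \<phi>"
  shows "uniform_limit K (\<lambda>k x. \<phi> (G k x)) (\<lambda>x. \<phi> (g x)) F"
proof -
  obtain y R where R: "\<And>x. x \<in> K \<Longrightarrow> dist y (g x) \<le> R"
    using assms(2) unfolding bounded_def by auto
  have "compact (cball y (R + 1))" by simp
  then have "uniformly_continuous_on (cball y (R + 1)) \<phi>"
    by (intro compact_uniformly_continuous continuous_on_subset[OF assms(3)]) auto
  moreover have "\<forall>\<^sub>F k in F. \<forall>x\<in>K. G k x \<in> cball y (R + 1)"
    using uniform_limitD[OF lim zero_less_one]
  proof eventually_elim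
    case (elim k)
    show ?case
    proof
      fix x assume "x \<in> K"
      then have "dist (G k x) (g x) < 1" using elim by blast
      with R[OF \<open>x \<in> K\<close>] dist_triangle[of y "G k x" "g x"] show "G k x \<in> cball y (R + 1)"
        by (simp add: dist_commute)
    qed
  qed
  ultimately show ?thesis
    using uniform_limit_compose_uniformly_continuous_on[OF lim] closed_cball by blast
qed

lemma uniform_limit_vec:
  fixes G :: "'k \<Rightarrow> 'a \<Rightarrow> real ^ 'i::finite"
  assumes "\<And>i. uniform_limit K (\<lambda>k x. G k x $ i) (\<lambda>x. g x $ i) F"
  shows "uniform_limit K G g F"
proof (rule uniform_limitI)
  fix e :: real assume "e > 0"
  define d where "d = e / CARD('i)"
  have "d > 0" using \<open>e > 0\<close> by (simp add: d_def)
  then have "\<forall>\<^sub>F k in F. \<forall>i. \<forall>x\<in>K. dist (G k x $ i) (g x $ i) < d"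
    using uniform_limitD[OF assms] by (simp add: eventually_all_finite)
  then show "\<forall>\<^sub>F k in F. \<forall>x\<in>K. dist (G k x) (g x) < e"
  proof eventually_elim
    case (elim k)
    show ?case
    proof
      fix x assume "x \<in> K"
      have "dist (G k x) (g x) \<le> (\<Sum>i\<in>UNIV. \<bar>(G k x - g x) $ i\<bar>)"
        unfolding dist_norm by (rule norm_le_l1_cart)
      also have "\<dots> < (\<Sum>i\<in>(UNIV::'i set). d)"
        using elim \<open>x \<in> K\<close> by (intro sum_strict_mono) (auto simp: dist_real_def)
      also have "\<dots> = e" by (simp add: d_def)
      finally show "dist (G k x) (g x) < e" .
    qed
  qed
qed

lemma uclosure_vec:
  fixes g :: "'a \<Rightarrow> real ^ 'i::finite"
  assumes "\<And>i. (\<lambda>x. g x $ i) \<in> uclosure K (S i)"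
  shows "g \<in> uclosure K {s. \<forall>i. (\<lambda>x. s x $ i) \<in> S i}"
proof -
  have "\<exists>s. (\<forall>n::nat. s n \<in> S i) \<and> uniform_limit K s (\<lambda>x. g x $ i) sequentially" for i
    using uclosure_sequence[OF assms] by metis
  then obtain s where s: "\<And>i n. s i n \<in> S i"
      "\<And>i. uniform_limit K (s i) (\<lambda>x. g x $ i) sequentially"
    by metis
  have "uniform_limit K (\<lambda>n x. \<chi> i. s i n x) g sequentially"
    using s(2) by (intro uniform_limit_vec) simp
  then show ?thesis
    by (rule uclosure_limit) (use s(1) in \<open>auto intro!: always_eventually subset_uclosure\<close>)
qed

section \<open>Shallow networks\<close>

text \<open>The inner functions are a parameter: they will be affine forms with free bias, forms
  with the fixed bias \<open>c\<close>, and, with the identity as \<open>\<rho>\<close>, monomials.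
  The rule \<open>const\<close> is the output bias.\<close>

inductive_set shallow :: "(real \<Rightarrow> real) \<Rightarrow> ('a \<Rightarrow> real) set \<Rightarrow> ('a \<Rightarrow> real) set"
  for \<rho> F where
  const: "(\<lambda>x. b) \<in> shallow \<rho> F"
| step: "\<lbrakk>f \<in> F; g \<in> shallow \<rho> F\<rbrakk> \<Longrightarrow> (\<lambda>x. a * \<rho> (f x) + g x) \<in> shallow \<rho> F"

lemma shallow_add:
  assumes "g \<in> shallow \<rho> F" and "g' \<in> shallow \<rho> F"
  shows "(\<lambda>x. g x + g' x) \<in> shallow \<rho> F"
  using assms(1)
proof induction
  case (const b)
  show ?case using assms(2)
  proof induction
    case (const b')
    show ?case by (rule shallow.const)
  next
    case (step f g' a)
    from shallow.step[OF this(1,3), of a] show ?case by (simp add: add_ac)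
  qed
next
  case (step f g a)
  from shallow.step[OF this(1,3), of a] show ?case by (simp add: add_ac)
qed

lemma shallow_scale:
  assumes "g \<in> shallow \<rho> F"
  shows "(\<lambda>x. t * g x) \<in> shallow \<rho> F"
  using assms
proof induction
  case (const b)
  show ?case by (rule shallow.const)
next
  case (step f g a)
  from shallow.step[OF this(1,3), of "t * a"] show ?case by (simp add: algebra_simps)
qed

lemma shallow_unit: "f \<in> F \<Longrightarrow> (\<lambda>x. \<rho> (f x)) \<in> shallow \<rho> F"
  using shallow.step[OF _ shallow.const[of 0], of f F 1] by simp

lemma shallow_compose:
  assumes "g \<in> shallow \<rho> F" and "\<And>f. f \<in> F \<Longrightarrow> (\<lambda>x. f (h x)) \<in> F'"
  shows "(\<lambda>x. g (h x)) \<in> shallow \<rho> F'"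
  using assms(1)
proof induction
  case (step f g a)
  show ?case by (rule shallow.step[OF assms(2)[OF step(1)] step(3)])
qed (rule shallow.const)

lemma shallow_continuous_on:
  assumes "g \<in> shallow \<rho> F" and "continuous_on UNIV \<rho>" and "\<And>f. f \<in> F \<Longrightarrow> continuous_on K f"
  shows "continuous_on K g"
  using assms(1)
proof induction
  case (step f g a)
  have "continuous_on K (\<lambda>x. \<rho> (f x))"
    by (rule continuous_on_compose2[OF assms(2) assms(3)[OF step(1)]]) simp
  with step(3) show ?case by (intro continuous_intros)
qed simp

abbreviation ushallow :: "(real \<Rightarrow> real) \<Rightarrow> 'a set \<Rightarrow> ('a \<Rightarrow> real) set \<Rightarrow> ('a \<Rightarrow> real) set" where
  "ushallow \<rho> K F \<equiv> uclosure K (shallow \<rho> F)"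

lemma ushallow_const: "(\<lambda>x. b) \<in> ushallow \<rho> K F"
  by (intro subset_uclosure shallow.const)

lemma ushallow_add:
  assumes "g \<in> ushallow \<rho> K F" and "g' \<in> ushallow \<rho> K F"
  shows "(\<lambda>x. g x + g' x) \<in> ushallow \<rho> K F"
proof -
  obtain s s' where "\<And>n::nat. s n \<in> shallow \<rho> F" "uniform_limit K s g sequentially"
    "\<And>n::nat. s' n \<in> shallow \<rho> F" "uniform_limit K s' g' sequentially"
    using assms uclosure_sequence by metis
  note s = this
  show ?thesis
    by (rule uclosure_limit[OF uniform_limit_add[OF s(2,4)]])
      (auto intro!: always_eventually subset_uclosure shallow_add s(1,3))
qed

lemma ushallow_scale:
  assumes "g \<in> ushallow \<rho> K F"
  shows "(\<lambda>x. t * g x) \<in> ushallow \<rho> K F"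
proof -
  obtain s where "\<And>n::nat. s n \<in> shallow \<rho> F" "uniform_limit K s g sequentially"
    using assms uclosure_sequence by metis
  note s = this
  show ?thesis
    by (rule uclosure_limit[OF bounded_linear.uniform_limit[OF bounded_linear_mult_right[of t] s(2)]])
      (auto intro!: always_eventually subset_uclosure shallow_scale s(1))
qed

lemma ushallow_sum:
  assumes "finite I" and "\<And>i. i \<in> I \<Longrightarrow> g i \<in> ushallow \<rho> K F"
  shows "(\<lambda>x. \<Sum>i\<in>I. g i x) \<in> ushallow \<rho> K F"
  using assms by (induction I rule: finite_induct) (simp_all add: ushallow_const ushallow_add)

section \<open>The square function\<close>

definition second_diff :: "(real \<Rightarrow> real) \<Rightarrow> real \<Rightarrow> real \<Rightarrow> real" where
  "second_diff g d x = g (x + d + d) - 2 * g (x + d) + g x"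

lemma continuous_antiderivative_UNIV:
  fixes f :: "real \<Rightarrow> real"
  assumes "continuous_on UNIV f"
  obtains P where "\<And>x. (P has_field_derivative f x) (at x)"
proof -
  have "\<exists>P. \<forall>x::real. -\<infinity> < ereal x \<longrightarrow> ereal x < \<infinity> \<longrightarrow> (P has_vector_derivative f x) (at x)"
    using assms by (intro einterval_antiderivative) (auto simp: continuous_on_eq_continuous_at)
  with that show ?thesis
    by (auto simp: has_real_derivative_iff_has_vector_derivative)
qed

text \<open>Integrating the additivity of \<open>f - f 0\<close> in one variable shows that \<open>f\<close> is differentiable with
  constant derivative.\<close>

lemma second_diff_zero_imp_affine:
  fixes f :: "real \<Rightarrow> real"
  assumes cont: "continuous_on UNIV f" and zero: "\<And>d x. d > 0 \<Longrightarrow> second_diff f d x = 0"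
  shows "affine_fun f"
proof -
  \<comment> \<open>For a negative step the hypothesis is read from the other end point.\<close>
  have mid: "f (x + d + d) = 2 * f (x + d) - f x" for x d
    using zero[of d x] zero[of "- d" "x + d + d"]
    by (cases d "0::real" rule: linorder_cases) (simp_all add: second_diff_def algebra_simps)
  have add: "f (x + y) = f x + f y - f 0" for x y
  proof -
    \<comment> \<open>The pairs \<open>0, x + y\<close> and \<open>x, y\<close> share the midpoint
      \<open>(x + y) / 2\<close>.\<close>
    have "0 + (x + y) / 2 + (x + y) / 2 = x + y" "x + (y - x) / 2 + (y - x) / 2 = y"
      "x + (y - x) / 2 = 0 + (x + y) / 2"
      by (simp_all add: field_simps)
    with mid[of 0 "(x + y) / 2"] mid[of x "(y - x) / 2"] show ?thesis by simp
  qed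
  obtain P where P: "\<And>x. (P has_field_derivative f x) (at x)"
    using continuous_antiderivative_UNIV[OF cont] by blast
  have P': "((\<lambda>y. P (y + t)) has_field_derivative f (x + t)) (at x)" for x t
    using DERIV_shift[of P "f (x + t)" x t] P by (simp add: add.commute)
  \<comment> \<open>For fixed \<open>x\<close> the derivative of \<open>P (y + x) - P y\<close> in
    \<open>y\<close> is the constant \<open>f x - f 0\<close>; comparing \<open>y = 1\<close> with
    \<open>y = 0\<close> expresses \<open>f\<close> by the differentiable \<open>P\<close>.\<close>
  have rep: "f x = P (x + 1) - P x - (P 1 - P 0) + f 0" for x
  proof -
    have "((\<lambda>y. P (y + x) - P y - y * (f x - f 0)) has_field_derivative 0) (at y)" for y
      using add[of y x] by (auto intro!: derivative_eq_intros P' P simp: algebra_simps)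
    then have "P (1 + x) - P 1 - 1 * (f x - f 0) = P (0 + x) - P 0 - 0 * (f x - f 0)"
      by (rule DERIV_isconst_all[rule_format, where f = "\<lambda>y. P (y + x) - P y - y * (f x - f 0)"])
    then show ?thesis by (simp add: add.commute)
  qed
  have "((\<lambda>x. P (x + 1) - P x - (P 1 - P 0) + f 0) has_field_derivative f 1 - f 0) (at x)" for x
    using add[of x 1] by (auto intro!: derivative_eq_intros P' P)
  moreover have "(\<lambda>x. P (x + 1) - P x - (P 1 - P 0) + f 0) = f"
    by (rule ext) (rule rep[symmetric])
  ultimately have "(f has_field_derivative f 1 - f 0) (at x)" for x
    by simp
  then have "((\<lambda>x. f x - x * (f 1 - f 0)) has_field_derivative 0) (at x)" for x
    by (auto intro!: derivative_eq_intros)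
  then have "f x - x * (f 1 - f 0) = f 0 - 0 * (f 1 - f 0)" for x
    by (rule DERIV_isconst_all[rule_format, where f = "\<lambda>x. f x - x * (f 1 - f 0)"])
  then have "f x = (f 1 - f 0) * x + f 0" for x
    by (simp add: algebra_simps)
  then show ?thesis unfolding affine_fun_def by blast
qed

abbreviation affs :: "(real \<Rightarrow> real) set" where
  "affs \<equiv> {f. \<exists>w d. f = (\<lambda>x. w * x + d)}"

text \<open>The hypothesis ranges over all intervals because the affine map sends
  \<open>{-R..R}\<close> into a larger one.\<close>

lemma ushallow_affine_compose:
  assumes "\<And>R. g \<in> ushallow \<rho> {-R..R} affs"
  shows "(\<lambda>x. g (w * x + d)) \<in> ushallow \<rho> {-R..R} affs"
proof (rule uclosure_compose[OF assms])
  have "\<bar>w * x + d\<bar> \<le> \<bar>w\<bar> * R + \<bar>d\<bar>" if "x \<in> {-R..R}" for x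
  proof -
    have "\<bar>w\<bar> * \<bar>x\<bar> \<le> \<bar>w\<bar> * R" using that by (intro mult_left_mono) auto
    then show ?thesis using abs_triangle_ineq[of "w * x" d] by (simp add: abs_mult)
  qed
  then show "(\<lambda>x. w * x + d) ` {-R..R} \<subseteq> {-(\<bar>w\<bar> * R + \<bar>d\<bar>)..\<bar>w\<bar> * R + \<bar>d\<bar>}"
    by (force simp: abs_le_iff)
  fix s assume "s \<in> shallow \<rho> affs"
  then show "(\<lambda>x. s (w * x + d)) \<in> shallow \<rho> affs"
  proof (rule shallow_compose)
    fix f :: "real \<Rightarrow> real" assume "f \<in> affs"
    then obtain v e where "f = (\<lambda>x. v * x + e)" by blast
    then have "(\<lambda>x. f (w * x + d)) = (\<lambda>x. (v * w) * x + (v * d + e))"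
      by (simp add: fun_eq_iff algebra_simps)
    then show "(\<lambda>x. f (w * x + d)) \<in> affs" by blast
  qed
qed

text \<open>Riemann sums of \<open>g\<close> are shallow networks and converge uniformly on bounded intervals.\<close>

lemma ushallow_antiderivative_diff:
  fixes g P :: "real \<Rightarrow> real"
  assumes P: "\<And>x. (P has_field_derivative g x) (at x)" and cont: "continuous_on UNIV g"
    and g: "\<And>R. g \<in> ushallow \<rho> {-R..R} affs" and "d > 0"
  shows "(\<lambda>x. P (x + d) - P x) \<in> ushallow \<rho> {-R..R} affs"
proof -
  define G where "G n x = d / n * (\<Sum>i<n. g (1 * x + i * (d / n)))" for n :: nat and x
  have mem: "G n \<in> ushallow \<rho> {-R..R} affs" for n
    unfolding G_def by (intro ushallow_scale ushallow_sum ushallow_affine_compose g) simp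
  have "uniform_limit {-R..R} G (\<lambda>x. P (x + d) - P x) sequentially"
  proof (rule uniform_limitI)
    fix e :: real assume "e > 0"
    \<comment> \<open>The \<open>n\<close> summands contribute at most \<open>d / n * e'\<close>
      each, hence \<open>e / 2\<close> in total.\<close>
    define e' where "e' = e / (2 * d)"
    have "e' > 0" using \<open>e > 0\<close> \<open>d > 0\<close> by (simp add: e'_def)
    have "uniformly_continuous_on {-R..R + d} g"
      by (intro compact_uniformly_continuous continuous_on_subset[OF cont]) auto
    then obtain r where "r > 0" and
      r: "\<And>x y. x \<in> {-R..R + d} \<Longrightarrow> y \<in> {-R..R + d} \<Longrightarrow> dist y x < r \<Longrightarrow> dist (g y) (g x) < e'"
      using \<open>e' > 0\<close> unfolding uniformly_continuous_on_def by metis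
    have "((\<lambda>n. d / real n) \<longlongrightarrow> 0) sequentially"
      by (rule lim_const_over_n)
    from order_tendstoD(2)[OF this \<open>r > 0\<close>]
    show "\<forall>\<^sub>F n in sequentially. \<forall>x\<in>{-R..R}. dist (G n x) (P (x + d) - P x) < e"
      using eventually_gt_at_top[of 0]
    proof eventually_elim
      case (elim n)
      show ?case
      proof
        fix x assume x: "x \<in> {-R..R}"
        define t where "t = d / n"
        have t: "0 < t" "t < r" "n * t = d"
          using elim \<open>d > 0\<close> by (simp_all add: t_def)
        have summand: "\<bar>t * g (x + i * t) - (P (x + Suc i * t) - P (x + i * t))\<bar> \<le> t * e'"
          if "i < n" for i
        proof -
          \<comment> \<open>The mean value theorem turns the exact increment of \<open>P\<close>
            into \<open>t * g z\<close>, so only the oscillation of \<open>g\<close> over one step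
            is left.\<close>
          have "x + i * t < x + Suc i * t" using t(1) by simp
          from MVT2[OF this P] obtain z where z: "x + i * t < z" "z < x + Suc i * t"
            "P (x + Suc i * t) - P (x + i * t) = (x + Suc i * t - (x + i * t)) * g z" by blast
          have "Suc i * t \<le> n * t" using that t(1) by (intro mult_right_mono) auto
          moreover have "0 \<le> i * t" using t(1) by simp
          moreover have "Suc i * t = i * t + t" by (simp add: algebra_simps)
          ultimately have "z \<in> {-R..R + d}" "x + i * t \<in> {-R..R + d}"
            using x z(1,2) t by (simp_all only: atLeastAtMost_iff) linarith+
          moreover have "dist (x + i * t) z < r"
            using z(1,2) t(2) by (simp add: dist_real_def algebra_simps)
          ultimately have "\<bar>g (x + i * t) - g z\<bar> \<le> e'"
            using r[of z "x + i * t"] by (simp add: dist_real_def)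
          then have "t * \<bar>g (x + i * t) - g z\<bar> \<le> t * e'"
            using t(1) by (intro mult_left_mono) auto
          moreover have "t * g (x + i * t) - (P (x + Suc i * t) - P (x + i * t))
              = t * (g (x + i * t) - g z)"
            unfolding z(3) by (simp add: algebra_simps)
          ultimately show ?thesis using t(1) by (simp only: abs_mult abs_of_pos)
        qed
        have "(\<Sum>i<n. P (x + Suc i * t) - P (x + i * t)) = P (x + d) - P x"
          using sum_lessThan_telescope[of "\<lambda>i. P (x + i * t)" n] t(3) by simp
        then have "G n x - (P (x + d) - P x) =
            (\<Sum>i<n. t * g (x + i * t) - (P (x + Suc i * t) - P (x + i * t)))"
          by (simp add: G_def t_def sum_subtractf sum_distrib_left)
        then have "\<bar>G n x - (P (x + d) - P x)\<bar> \<le> (\<Sum>i<n. t * e')"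
          using summand by (simp only:) (rule order_trans[OF sum_abs sum_mono], simp)
        also have "\<dots> = d * e'" using t(3) by simp
        also have "\<dots> < e" using \<open>e > 0\<close> \<open>d > 0\<close> by (simp add: e'_def)
        finally show "dist (G n x) (P (x + d) - P x) < e" by (simp add: dist_real_def)
      qed
    qed
  qed
  then show ?thesis by (rule uclosure_limit) (simp_all add: mem)
qed

text \<open>One form for both signs of \<open>u\<close> and for \<open>u = 0\<close>, locating the
  intermediate point only as closely as continuity of \<open>g''\<close> requires.\<close>

lemma taylor_two:
  fixes g g' g'' :: "real \<Rightarrow> real"
  assumes "\<And>x. (g has_field_derivative g' x) (at x)"
    and "\<And>x. (g' has_field_derivative g'' x) (at x)"
  shows "\<exists>t. \<bar>t - x\<bar> \<le> \<bar>u\<bar> \<and> g (x + u) = g x + g' x * u + g'' t / 2 * u ^ 2"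
proof (cases "u = 0")
  case False
  define diff where "diff m = (if m = 0 then g else if m = 1 then g' else g'')" for m :: nat
  have "\<exists>t. (if x + u < x then x + u < t \<and> t < x else x < t \<and> t < x + u) \<and>
    g (x + u) = (\<Sum>m<2. (diff m x / fact m) * (x + u - x)^m) + (diff 2 t / fact 2) * (x + u - x)^2"
  proof (rule Taylor)
    show "\<forall>m t. m < 2 \<and> x - \<bar>u\<bar> \<le> t \<and> t \<le> x + \<bar>u\<bar> \<longrightarrow> DERIV (diff m) t :> diff (Suc m) t"
      using assms by (auto simp: diff_def less_2_cases_iff)
  qed (use False in \<open>auto simp: diff_def\<close>)
  then obtain t where t: "if x + u < x then x + u < t \<and> t < x else x < t \<and> t < x + u"
    "g (x + u) = (\<Sum>m<2. (diff m x / fact m) * (x + u - x)^m) + (diff 2 t / fact 2) * (x + u - x)^2"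
    by blast
  have "\<bar>t - x\<bar> \<le> \<bar>u\<bar>" using t(1) by (auto split: if_splits)
  moreover have "g (x + u) = g x + g' x * u + g'' t / 2 * u ^ 2"
    using t(2) by (simp add: diff_def numeral_2_eq_2)
  ultimately show ?thesis by blast
qed auto

text \<open>The symmetric second difference of \<open>g\<close> at \<open>x0\<close> with step
  \<open>h * x\<close>, divided by \<open>g'' x0 * h^2\<close>, tends to \<open>x^2\<close> as
  \<open>h\<close> tends to 0, uniformly for bounded \<open>x\<close>.\<close>

lemma ushallow_square_if_second_derivative:
  fixes g g' g'' :: "real \<Rightarrow> real"
  assumes g': "\<And>x. (g has_field_derivative g' x) (at x)"
    and g'': "\<And>x. (g' has_field_derivative g'' x) (at x)"
    and cont: "isCont g'' x0" and nz: "g'' x0 \<noteq> 0"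
    and g: "\<And>R. g \<in> ushallow \<rho> {-R..R} affs"
  shows "(\<lambda>x. x ^ 2) \<in> ushallow \<rho> {-R..R} affs"
proof -
  define G where
    "G h x = 1 / (g'' x0 * h ^ 2) * ((g (h * x + x0) + g (- h * x + x0)) + (- 2 * g x0))" for h x
  have mem: "G h \<in> ushallow \<rho> {-R..R} affs" for h
    unfolding G_def
    by (rule ushallow_scale[OF ushallow_add[OF ushallow_add[OF ushallow_affine_compose[OF g]
          ushallow_affine_compose[OF g]] ushallow_const]])
  have "uniform_limit {-R..R} G (\<lambda>x. x ^ 2) (at_right 0)"
  proof (rule uniform_limitI)
    fix e :: real assume "e > 0"
    define e' where "e' = e * \<bar>g'' x0\<bar> / (R ^ 2 + 1)"
    have "R ^ 2 + 1 > 0" by (intro add_nonneg_pos) auto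
    then have "e' > 0" using \<open>e > 0\<close> nz by (simp add: e'_def)
    then obtain d where "d > 0" and d: "\<And>y. \<bar>y - x0\<bar> < d \<Longrightarrow> \<bar>g'' y - g'' x0\<bar> < e'"
      using cont unfolding continuous_at_eps_delta by (metis dist_real_def)
    have "\<forall>\<^sub>F h in at_right 0. h \<in> {0<..<d / (\<bar>R\<bar> + 1)}"
      using \<open>d > 0\<close> by (intro eventually_at_right_real) simp
    then show "\<forall>\<^sub>F h in at_right 0. \<forall>x\<in>{-R..R}. dist (G h x) (x ^ 2) < e"
    proof eventually_elim
      case (elim h)
      then have h: "h > 0" "h * (\<bar>R\<bar> + 1) < d" by (simp_all add: field_simps)
      show ?case
      proof
        fix x assume "x \<in> {-R..R}"
        then have x: "\<bar>x\<bar> \<le> \<bar>R\<bar>" by auto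
        have "h * \<bar>x\<bar> \<le> h * (\<bar>R\<bar> + 1)" using h(1) x by (intro mult_left_mono) auto
        then have "h * \<bar>x\<bar> < d" using h(2) by linarith
        then have small: "\<bar>h * x\<bar> < d" using h(1) by (simp add: abs_mult)
        obtain t1 where t1: "\<bar>t1 - x0\<bar> \<le> \<bar>h * x\<bar>"
          "g (x0 + h * x) = g x0 + g' x0 * (h * x) + g'' t1 / 2 * (h * x) ^ 2"
          using taylor_two[OF g' g''] by blast
        obtain t2 where t2: "\<bar>t2 - x0\<bar> \<le> \<bar>- h * x\<bar>"
          "g (x0 + - h * x) = g x0 + g' x0 * (- h * x) + g'' t2 / 2 * (- h * x) ^ 2"
          using taylor_two[OF g' g''] by blast
        \<comment> \<open>First-order terms cancel by symmetry; \<open>q\<close> is the mean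
          deviation of \<open>g''\<close> at the two Taylor points from
          \<open>g'' x0\<close>.\<close>
        define q where "q = (g'' t1 - g'' x0 + (g'' t2 - g'' x0)) / 2"
        have "\<bar>q\<bar> < e'"
          using d[of t1] d[of t2] t1(1) t2(1) small by (simp add: q_def)
        have "g (h * x + x0) + g (- h * x + x0) + (- 2 * g x0) = (h * x) ^ 2 * (q + g'' x0)"
        proof -
          have "q + g'' x0 = (g'' t1 + g'' t2) / 2" by (simp add: q_def field_simps)
          with t1(2) t2(2) show ?thesis
            unfolding add.commute[of x0] by (simp only:) (simp add: field_simps)
        qed
        then have "G h x - x ^ 2 = x ^ 2 * q / g'' x0"
          using h(1) nz by (simp add: G_def power_mult_distrib divide_simps) (simp add: algebra_simps)
        then have "\<bar>G h x - x ^ 2\<bar> = x ^ 2 * \<bar>q\<bar> / \<bar>g'' x0\<bar>"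
          by (simp add: abs_mult)
        also have "\<dots> \<le> R ^ 2 * e' / \<bar>g'' x0\<bar>"
          using x \<open>\<bar>q\<bar> < e'\<close> by (intro divide_right_mono mult_mono) (auto simp: abs_le_square_iff)
        also have "\<dots> < e"
          using nz \<open>e > 0\<close> \<open>R ^ 2 + 1 > 0\<close> by (simp add: e'_def divide_simps)
        finally show "dist (G h x) (x ^ 2) < e" by (simp add: dist_real_def)
      qed
    qed
  qed
  then show ?thesis by (rule uclosure_limit) (simp_all add: mem)
qed

text \<open>Integrating \<open>\<rho>\<close> twice over a moving interval of length \<open>d\<close> gives a twice continuously
  differentiable function whose second derivative is the second difference of \<open>\<rho>\<close>.\<close>

lemma ushallow_square:
  assumes cont: "continuous_on UNIV \<rho>" and "\<not> affine_fun \<rho>"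
  shows "(\<lambda>x. x ^ 2) \<in> ushallow \<rho> {-R..R} affs"
proof -
  obtain d x0 where "d > 0" and nz: "second_diff \<rho> d x0 \<noteq> 0"
    using second_diff_zero_imp_affine[OF cont] assms(2) by blast
  obtain P where P: "\<And>x. (P has_field_derivative \<rho> x) (at x)"
    using continuous_antiderivative_UNIV[OF cont] by blast
  have contP: "continuous_on UNIV P"
    using P by (meson DERIV_isCont continuous_at_imp_continuous_on)
  obtain Q where Q: "\<And>x. (Q has_field_derivative P x) (at x)"
    using continuous_antiderivative_UNIV[OF contP] by blast
  have shift: "((\<lambda>x. F (x + d)) has_field_derivative f (x + d)) (at x)"
    if "\<And>x. (F has_field_derivative f x) (at x)" for F f :: "real \<Rightarrow> real" and x
    using DERIV_shift[of F "f (x + d)" x d] that by (simp add: add.commute)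
  define D where "D F x = F (x + d) - F x" for F :: "real \<Rightarrow> real" and x
  have D: "(D F has_field_derivative D f x) (at x)"
    if "\<And>x. (F has_field_derivative f x) (at x)" for F f :: "real \<Rightarrow> real" and x
    unfolding D_def by (intro DERIV_diff shift that)
  have contD: "continuous_on UNIV (D F)" if "continuous_on UNIV F" for F
    unfolding D_def
    by (intro continuous_intros that continuous_on_compose2[OF that]) auto
  have "(\<lambda>x. \<rho> (1 * x + 0)) \<in> ushallow \<rho> {-R..R} affs" for R
    by (intro subset_uclosure shallow_unit) blast
  then have \<rho>: "\<rho> \<in> ushallow \<rho> {-R..R} affs" for R by simp
  have "D P \<in> ushallow \<rho> {-R..R} affs" for R
    unfolding D_def by (rule ushallow_antiderivative_diff[OF P cont \<rho> \<open>d > 0\<close>])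
  \<comment> \<open>\<open>D Q\<close> is an antiderivative of \<open>D P\<close>, so the averaging
    lemma applies a second time; the second derivative of \<open>D (D Q)\<close> is
    \<open>D (D \<rho>)\<close>.\<close>
  then have mem: "D (D Q) \<in> ushallow \<rho> {-R..R} affs" for R
    unfolding D_def[of "D Q"]
    by (rule ushallow_antiderivative_diff[OF D[OF Q] contD[OF contP] _ \<open>d > 0\<close>])
  have "isCont (D (D \<rho>)) x0"
    using contD[OF contD[OF cont]] by (simp add: continuous_on_eq_continuous_at)
  moreover have "D (D \<rho>) x0 \<noteq> 0"
    using nz by (simp add: D_def second_diff_def)
  ultimately show ?thesis
    by (rule ushallow_square_if_second_derivative[OF D[OF D[OF Q]] D[OF D[OF P]] _ _ mem])
qed

section \<open>Parallel blocks\<close>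

definition row_matrix :: "'k \<Rightarrow> real ^ 'k \<Rightarrow> real ^ 'k ^ 'k" where
  "row_matrix i v = (\<chi> a j. if a = i then v $ j else 0)"

lemma row_matrix_mult: "(row_matrix i v *v z) $ a = (if a = i then v \<bullet> z else 0)"
  by (simp add: row_matrix_def matrix_vector_mult_def inner_vec_def)

text \<open>Take coefficient 0 for the identity, and let one column of \<open>U\<close> be the
  \<open>i\<close>-th unit vector and the same column of \<open>V\<close> be \<open>v\<close>. Zero
  columns fill up any rank; \<open>undefined\<close> merely names some column.\<close>

lemma dlor_component_row_matrix: "dlor_component R (row_matrix i v)"
  for R :: "'r::finite itself" and v :: "real ^ 'k"
proof -
  define U :: "real ^ 'r ^ 'k" where "U = (\<chi> a r. if r = undefined then if a = i then 1 else 0 else 0)"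
  define V :: "real ^ 'r ^ 'k" where "V = (\<chi> j r. if r = undefined then v $ j else 0)"
  have "row_matrix i v = 0 *\<^sub>R mat 1 + U ** transpose V"
    by (simp add: vec_eq_iff row_matrix_def U_def V_def matrix_matrix_mult_def transpose_def
        if_distrib[of "\<lambda>t. t * _"] cong: if_cong)
  then show ?thesis unfolding dlor_component_def by blast
qed

text \<open>Components may be indexed by any finite set, here later by pairs of a coordinate and a
  unit plus two extra tags.\<close>

lemma parallel_dlor_blockI:
  fixes \<beta> :: "'x \<Rightarrow> real" and M :: "'x \<Rightarrow> real ^ 'k ^ 'k"
  assumes "finite I" and "2 \<le> card I" and "0 < h" and "\<And>p. p \<in> I \<Longrightarrow> \<beta> p \<noteq> 0"
    and "sum \<beta> I = 0" and "\<And>p. p \<in> I \<Longrightarrow> dlor_component R (M p)"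
  shows "parallel_dlor_block R \<rho> c (\<lambda>z. entrywise \<rho>
    ((\<Sum>p\<in>I. (\<beta> p / (h * deriv \<rho> c)) *\<^sub>R
        entrywise \<rho> ((h / \<beta> p) *\<^sub>R (M p *v z) + c *\<^sub>R vec 1)) + b))"
proof -
  obtain e where e: "bij_betw e {..<card I} I"
    using ex_bij_betw_nat_finite[OF assms(1)] by (auto simp: atLeast0LessThan)
  have "e l \<in> I" if "l < card I" for l
    using e that by (auto simp: bij_betw_def)
  moreover have "(\<Sum>l<card I. \<beta> (e l)) = 0"
    using sum.reindex_bij_betw[OF e, of \<beta>] assms(5) by simp
  moreover have "(\<lambda>z. entrywise \<rho>
    ((\<Sum>p\<in>I. (\<beta> p / (h * deriv \<rho> c)) *\<^sub>R
        entrywise \<rho> ((h / \<beta> p) *\<^sub>R (M p *v z) + c *\<^sub>R vec 1)) + b)) =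
    parallel_block \<rho> c (card I) h (\<lambda>l. \<beta> (e l)) (\<lambda>l. M (e l)) b"
    unfolding parallel_block_def by (simp only: sum.reindex_bij_betw[OF e, symmetric])
  ultimately show ?thesis
    unfolding parallel_dlor_block_def
    by (intro exI[of _ "card I"] exI[of _ h] exI[of _ "\<lambda>l. \<beta> (e l)"] exI[of _ "\<lambda>l. M (e l)"]
        exI[of _ b] conjI) (simp_all add: assms)
qed

text \<open>Terms with coefficient 0 are dropped, since the coefficients turn into the non-zero
  \<open>\<beta>\<close> of a block.\<close>

lemma shallow_as_sum:
  assumes "g \<in> shallow \<rho> (range f)"
  shows "\<exists>L a v b. (\<forall>l<L::nat. a l \<noteq> 0) \<and> g = (\<lambda>x. (\<Sum>l<L. a l * \<rho> (f (v l) x)) + b)"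
  using assms
proof induction
  case (const b)
  show ?case by (rule exI[of _ 0]) auto
next
  case (step f' g a)
  then obtain L a' v b w where L: "\<forall>l<L::nat. a' l \<noteq> 0"
    "g = (\<lambda>x. (\<Sum>l<L. a' l * \<rho> (f (v l) x)) + b)" "f' = f w"
    by blast
  show ?case
  proof (cases "a = 0")
    case True
    with L show ?thesis by auto
  next
    case False
    have "\<forall>l<Suc L. (a'(L := a)) l \<noteq> 0"
      using L(1) False by (simp add: less_Suc_eq)
    moreover have "(\<lambda>x. a * \<rho> (f' x) + g x) =
      (\<lambda>x. (\<Sum>l<Suc L. (a'(L := a)) l * \<rho> (f ((v(L := w)) l) x)) + b)"
      by (simp add: L(2,3) fun_eq_iff)
    ultimately show ?thesis by blast
  qed
qed

text \<open>A row matrix feeds a single coordinate, so the coordinates carry independent shallow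
  networks; two further components with zero matrix balance the coefficients to sum \<open>0\<close>.\<close>

lemma parallel_dlor_block_shallow:
  fixes s :: "real ^ 'k \<Rightarrow> real ^ 'k" and R :: "'r::finite itself"
  assumes nz: "deriv \<rho> c \<noteq> 0"
    and s: "\<And>i. (\<lambda>z. s z $ i) \<in> shallow \<rho> (range (\<lambda>v z. v \<bullet> z + c))"
  shows "parallel_dlor_block R \<rho> c (\<lambda>z. entrywise \<rho> (s z))"
proof -
  define rep where "rep i L a v b \<longleftrightarrow> (\<forall>l<L::nat. a l \<noteq> 0) \<and>
      (\<lambda>z. s z $ i) = (\<lambda>z. (\<Sum>l<L. a l * \<rho> (v l \<bullet> z + c)) + b)" for i L a v b
  have "\<forall>i. \<exists>L a v b. rep i L a v b"
    unfolding rep_def using shallow_as_sum[OF s] by blast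
  then obtain L a v b where "\<And>i. rep i (L i) (a i) (v i) (b i)"
    by metis
  then have a: "\<And>i l. l < L i \<Longrightarrow> a i l \<noteq> 0"
    and sum: "\<And>i. (\<lambda>z. s z $ i) = (\<lambda>z. (\<Sum>l<L i. a i l * \<rho> (v i l \<bullet> z + c)) + b i)"
    unfolding rep_def by blast+
  define J where "J = Sigma UNIV (\<lambda>i. {..<L i})"
  have finJ: "finite J" by (simp add: J_def)
  define \<rho>' where "\<rho>' = deriv \<rho> c"
  define S where "S = (\<Sum>(i, l)\<in>J. a i l * \<rho>')"
  define I where "I = J <+> (UNIV :: bool set)"
  \<comment> \<open>With \<open>h = 1\<close> the factor \<open>\<beta> / \<rho>'\<close> becomes
    \<open>a i l\<close>, and the scaling of \<open>v i l\<close> in \<open>M\<close> cancels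
    \<open>1 / \<beta>\<close>. The last two values add up to \<open>- S\<close>; splitting it this
    way keeps both non-zero even for \<open>S = 0\<close>.\<close>
  define \<beta> where "\<beta> = case_sum (\<lambda>(i, l). a i l * \<rho>')
    (\<lambda>t. if t then \<bar>S\<bar> + 1 else - S - (\<bar>S\<bar> + 1))"
  define M where "M = case_sum (\<lambda>(i, l). row_matrix i ((a i l * \<rho>') *\<^sub>R v i l))
    (\<lambda>t::bool. row_matrix undefined 0)"
  \<comment> \<open>A component also emits a multiple of \<open>\<rho> c\<close> in every coordinate
    it does not feed, and the two balancing ones do so everywhere; the bias removes these
    constants.\<close>
  define b' where "b' = (\<chi> j. b j - (\<Sum>(i, l)\<in>J. a i l * (if j = i then 0 else \<rho> c)) + S / \<rho>' * \<rho> c)"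
  have "(\<Sum>p\<in>I. (\<beta> p / (1 * \<rho>')) *\<^sub>R
      entrywise \<rho> ((1 / \<beta> p) *\<^sub>R (M p *v z) + c *\<^sub>R vec 1)) + b' = s z" (is "?T + _ = _") for z
  proof (rule iffD2[OF vec_eq_iff], rule allI)
    fix j
    have "?T $ j = (\<Sum>(i, l)\<in>J. a i l * (if j = i then \<rho> (v i l \<bullet> z + c) else \<rho> c)) - S / \<rho>' * \<rho> c"
    proof -
      have "?T $ j = (\<Sum>p\<in>I. (\<beta> p / \<rho>') * \<rho> ((1 / \<beta> p) * (M p *v z) $ j + c))"
        by (simp add: entrywise_def)
      also have "\<dots> = (\<Sum>(i, l)\<in>J. a i l * (if j = i then \<rho> (v i l \<bullet> z + c) else \<rho> c))
          + (\<Sum>t\<in>UNIV. \<beta> (Inr t) / \<rho>' * \<rho> c)"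
        unfolding I_def using finJ
        by (subst sum.Plus) (auto intro!: arg_cong2[where f = plus] sum.cong
            simp: \<beta>_def M_def J_def row_matrix_mult nz \<rho>'_def a)
      also have "(\<Sum>t\<in>UNIV. \<beta> (Inr t) / \<rho>' * \<rho> c) = - (S / \<rho>' * \<rho> c)"
        using nz by (simp add: UNIV_bool \<beta>_def \<rho>'_def field_simps)
      finally show ?thesis by simp
    qed
    then have "(?T + b') $ j =
        (\<Sum>(i, l)\<in>J. a i l * (if j = i then \<rho> (v i l \<bullet> z + c) else \<rho> c) -
           a i l * (if j = i then 0 else \<rho> c)) + b j"
      by (simp add: b'_def case_prod_unfold sum_subtractf)
    also have "(\<Sum>(i, l)\<in>J. a i l * (if j = i then \<rho> (v i l \<bullet> z + c) else \<rho> c) -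
           a i l * (if j = i then 0 else \<rho> c)) =
        (\<Sum>(i, l)\<in>J. if i = j then a i l * \<rho> (v i l \<bullet> z + c) else 0)"
      by (intro sum.cong) auto
    also have "\<dots> = (\<Sum>i\<in>UNIV. \<Sum>l<L i. if i = j then a i l * \<rho> (v i l \<bullet> z + c) else 0)"
      unfolding J_def by (subst sum.Sigma) auto
    also have "\<dots> = (\<Sum>i\<in>UNIV. if i = j then \<Sum>l<L i. a i l * \<rho> (v i l \<bullet> z + c) else 0)"
      by (intro sum.cong) auto
    also have "\<dots> = (\<Sum>l<L j. a j l * \<rho> (v j l \<bullet> z + c))"
      by simp
    also have "\<dots> + b j = s z $ j"
      using fun_cong[OF sum[of j], of z] by simp
    finally show "(?T + b') $ j = s z $ j" .
  qed
  moreover have "parallel_dlor_block R \<rho> c (\<lambda>z. entrywise \<rho>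
    ((\<Sum>p\<in>I. (\<beta> p / (1 * deriv \<rho> c)) *\<^sub>R
        entrywise \<rho> ((1 / \<beta> p) *\<^sub>R (M p *v z) + c *\<^sub>R vec 1)) + b'))"
  proof (rule parallel_dlor_blockI)
    show "finite I" using finJ by (simp add: I_def)
    show "2 \<le> card I" using finJ by (simp add: I_def card_Plus)
    show "\<beta> p \<noteq> 0" if "p \<in> I" for p
      using that a nz by (auto simp: I_def J_def \<beta>_def \<rho>'_def split: if_splits)
    show "sum \<beta> I = 0"
      using finJ by (simp add: I_def sum.Plus \<beta>_def UNIV_bool S_def case_prod_unfold)
    show "dlor_component R (M p)" if "p \<in> I" for p
      by (auto simp: M_def dlor_component_row_matrix split: sum.split)
  qed simp
  ultimately show ?thesis by (simp add: \<rho>'_def)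
qed

lemma continuous_on_entrywise:
  assumes "continuous_on UNIV \<rho>" and "continuous_on S f"
  shows "continuous_on S (\<lambda>x. entrywise \<rho> (f x))"
  unfolding entrywise_def
  by (intro continuous_on_vec_lambda continuous_on_compose2[OF assms(1)]
      continuous_on_component assms(2)) auto

lemma continuous_on_parallel_dlor_block:
  assumes "parallel_dlor_block R \<rho> c B" and "continuous_on UNIV \<rho>"
  shows "continuous_on UNIV B"
proof -
  obtain L h \<beta> M b where B: "B = parallel_block \<rho> c L h \<beta> M b"
    using assms(1) unfolding parallel_dlor_block_def by blast
  have M: "continuous_on UNIV (\<lambda>z. M l *v z)" for l
    by (rule linear_continuous_on) (rule matrix_vector_mul_bounded_linear)
  show ?thesis
    unfolding B parallel_block_def
    by (intro continuous_on_entrywise[OF assms(2)] continuous_intros M)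
qed

section \<open>Reachable states\<close>

text \<open>A first-order inverse of \<open>t \<mapsto> \<rho> (c + e * t)\<close> that is affine in
  the stored value, so that a linear form together with a bias can compute it.\<close>

definition difference_quotient :: "(real \<Rightarrow> real) \<Rightarrow> real \<Rightarrow> real \<Rightarrow> real \<Rightarrow> real" where
  "difference_quotient \<rho> c e t = (\<rho> (c + e * t) - \<rho> c) / (e * deriv \<rho> c)"

text \<open>The error is \<open>t / deriv \<rho> c\<close> times the error of the Newton quotient of
  \<open>\<rho>\<close> at \<open>c\<close> with increment \<open>e * t\<close>, which is small
  uniformly for bounded \<open>t\<close>.\<close>

lemma uniform_limit_difference_quotient:
  assumes diff: "\<rho> differentiable (at c)" and nz: "deriv \<rho> c \<noteq> 0"
  shows "uniform_limit {-R..R} (difference_quotient \<rho> c) (\<lambda>t. t) (at_right 0)"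
proof (rule uniform_limitI)
  fix e :: real assume "e > 0"
  define \<rho>' where "\<rho>' = deriv \<rho> c"
  have \<rho>': "(\<rho> has_field_derivative \<rho>') (at c)"
    using diff by (simp add: \<rho>'_def DERIV_deriv_iff_real_differentiable)
  define e' where "e' = e * \<bar>\<rho>'\<bar> / (\<bar>R\<bar> + 1)"
  have "e' > 0" using \<open>e > 0\<close> nz by (simp add: e'_def \<rho>'_def)
  with \<rho>' obtain d where "d > 0" and
    d: "\<And>u. u \<noteq> 0 \<Longrightarrow> \<bar>u\<bar> < d \<Longrightarrow> \<bar>(\<rho> (c + u) - \<rho> c) / u - \<rho>'\<bar> < e'"
    unfolding DERIV_def LIM_def by (auto simp: dist_real_def)
  have "\<forall>\<^sub>F h in at_right 0. h \<in> {0<..<d / (\<bar>R\<bar> + 1)}"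
    using \<open>d > 0\<close> by (intro eventually_at_right_real) simp
  then show "\<forall>\<^sub>F h in at_right 0. \<forall>t\<in>{-R..R}. dist (difference_quotient \<rho> c h t) t < e"
  proof eventually_elim
    case (elim h)
    then have h: "h > 0" "h * (\<bar>R\<bar> + 1) < d" by (simp_all add: field_simps)
    show ?case
    proof
      fix t assume "t \<in> {-R..R}"
      then have t: "\<bar>t\<bar> \<le> \<bar>R\<bar>" by auto
      show "dist (difference_quotient \<rho> c h t) t < e"
      proof (cases "t = 0")
        case True
        then show ?thesis using \<open>e > 0\<close> by (simp add: difference_quotient_def)
      next
        case False
        have "h * \<bar>t\<bar> \<le> h * (\<bar>R\<bar> + 1)" using h(1) t by (intro mult_left_mono) auto
        then have "h * \<bar>t\<bar> < d" using h(2) by linarith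
        then have "\<bar>(\<rho> (c + h * t) - \<rho> c) / (h * t) - \<rho>'\<bar> < e'" (is "\<bar>?q\<bar> < _")
          using d[of "h * t"] h(1) False by (simp add: abs_mult)
        moreover have "difference_quotient \<rho> c h t - t = t * ?q / \<rho>'"
          using h(1) False nz by (simp add: difference_quotient_def \<rho>'_def field_simps)
        ultimately have "\<bar>difference_quotient \<rho> c h t - t\<bar> \<le> \<bar>R\<bar> * e' / \<bar>\<rho>'\<bar>"
          using t by (auto simp: abs_mult intro!: divide_right_mono mult_mono)
        also have "\<dots> < e"
          using nz \<open>e > 0\<close> by (simp add: e'_def \<rho>'_def divide_simps)
        finally show ?thesis by (simp add: dist_real_def)
      qed
    qed
  qed
qed

text \<open>The input embedding \<open>p\<close> and the index type stay abstract; all that matters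
  is a coordinate \<open>k\<^sub>0\<close> left empty by \<open>p\<close>, which will carry the
  constant.\<close>

locale dlor_states =
  fixes R :: "'r::finite itself" and \<rho> :: "real \<Rightarrow> real" and c b\<^sub>0 :: real
    and K :: "'a::topological_space set" and p :: "'a \<Rightarrow> real ^ 'k" and k\<^sub>0 :: 'k
  assumes cont: "continuous_on UNIV \<rho>" and not_affine: "\<not> affine_fun \<rho>"
    and diff: "\<rho> differentiable (at c)" and nz: "deriv \<rho> c \<noteq> 0"
    and b\<^sub>0: "\<rho> b\<^sub>0 \<noteq> 0"
    and K: "compact K" and p: "continuous_on K p" and p_k\<^sub>0: "\<And>x. p x $ k\<^sub>0 = 0"
begin

definition nets :: "('a \<Rightarrow> real ^ 'k) set" where
  "nets = {g. \<exists>Bs. Bs \<noteq> [] \<and> (\<forall>B\<in>set Bs. parallel_dlor_block R \<rho> c B) \<and>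
     g = (\<lambda>x. fold (\<lambda>B z. B z) Bs (p x))}"

abbreviation "reach \<equiv> uclosure K nets"

lemma nets_block:
  assumes "g \<in> nets" and "parallel_dlor_block R \<rho> c B"
  shows "(\<lambda>x. B (g x)) \<in> nets"
proof -
  obtain Bs where "Bs \<noteq> []" "\<forall>B\<in>set Bs. parallel_dlor_block R \<rho> c B"
    "g = (\<lambda>x. fold (\<lambda>B z. B z) Bs (p x))"
    using assms(1) unfolding nets_def by blast
  then show ?thesis
    unfolding nets_def using assms(2) by (intro CollectI exI[of _ "Bs @ [B]"]) auto
qed

lemma block_input: "parallel_dlor_block R \<rho> c B \<Longrightarrow> (\<lambda>x. B (p x)) \<in> nets"
  unfolding nets_def by (intro CollectI exI[of _ "[B]"]) auto

lemma continuous_on_nets: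
  assumes "g \<in> nets"
  shows "continuous_on K g"
proof -
  obtain Bs where Bs: "\<forall>B\<in>set Bs. parallel_dlor_block R \<rho> c B"
    and g: "g = (\<lambda>x. fold (\<lambda>B z. B z) Bs (p x))"
    using assms unfolding nets_def by blast
  from Bs p show ?thesis
    unfolding g
  proof (induction Bs arbitrary: p)
    case (Cons B Bs)
    have "continuous_on K (\<lambda>x. B (p x))"
      by (rule continuous_on_compose2[OF continuous_on_parallel_dlor_block[OF _ cont] Cons.prems(2)])
        (use Cons.prems(1) in auto)
    with Cons.IH[of "\<lambda>x. B (p x)"] Cons.prems(1) show ?case by simp
  qed simp
qed

lemma continuous_on_reach: "g \<in> reach \<Longrightarrow> continuous_on K g"
  using uclosure_continuous_on continuous_on_nets by blast

lemma bounded_image: "continuous_on K g \<Longrightarrow> bounded (g ` K)"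
  for g :: "'a \<Rightarrow> 'b::metric_space"
  by (intro compact_imp_bounded compact_continuous_image K)

lemma reach_block:
  assumes "g \<in> reach" and "parallel_dlor_block R \<rho> c B"
  shows "(\<lambda>x. B (g x)) \<in> reach"
proof -
  obtain s where s: "\<And>n::nat. s n \<in> nets" "uniform_limit K s g sequentially"
    using uclosure_sequence[OF assms(1)] by blast
  have "uniform_limit K (\<lambda>n x. B (s n x)) (\<lambda>x. B (g x)) sequentially"
    by (rule uniform_limit_continuous_compose[OF s(2) bounded_image[OF continuous_on_reach[OF assms(1)]]
          continuous_on_parallel_dlor_block[OF assms(2) cont]])
  then show ?thesis
    by (rule uclosure_limit) (simp_all add: subset_uclosure[OF nets_block[OF s(1) assms(2)]])
qed

text \<open>The hypothesis speaks of blocks applied to \<open>\<Phi>\<close> rather than of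
  \<open>\<Phi>\<close> being reachable, because it must cover the raw input, while
  \<open>nets\<close> demands at least one block.\<close>

lemma reach_layer:
  assumes blk: "\<And>B. parallel_dlor_block R \<rho> c B \<Longrightarrow> (\<lambda>x. B (\<Phi> x)) \<in> reach"
    and s: "\<And>i. (\<lambda>x. s x $ i) \<in> shallow \<rho> (range (\<lambda>v x. v \<bullet> \<Phi> x + c))"
  shows "(\<lambda>x. entrywise \<rho> (s x)) \<in> reach"
proof -
  have factor: "\<exists>t\<in>shallow \<rho> (range (\<lambda>v z. v \<bullet> z + c)). g = (\<lambda>x. t (\<Phi> x))"
    if "g \<in> shallow \<rho> (range (\<lambda>v x. v \<bullet> \<Phi> x + c))" for g
    using that
  proof induction
    case (const b)
    show ?case by (rule bexI[OF _ shallow.const[of b]]) simp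
  next
    case (step f g a)
    then obtain t v where t: "t \<in> shallow \<rho> (range (\<lambda>v z. v \<bullet> z + c))" "g = (\<lambda>x. t (\<Phi> x))"
      "f = (\<lambda>x. v \<bullet> \<Phi> x + c)" by blast
    show ?case
      by (rule bexI[OF _ shallow.step[OF rangeI[of _ v] t(1), of a]]) (simp add: t)
  qed
  define T where "T i t \<longleftrightarrow> t \<in> shallow \<rho> (range (\<lambda>v z. v \<bullet> z + c)) \<and> (\<lambda>x. s x $ i) = (\<lambda>x. t (\<Phi> x))"
    for i t
  have "\<forall>i. \<exists>t. T i t" using factor[OF s] unfolding T_def by blast
  then obtain t where T: "\<And>i. T i (t i)" by metis
  have "parallel_dlor_block R \<rho> c (\<lambda>z. entrywise \<rho> (\<chi> i. t i z))"
    by (rule parallel_dlor_block_shallow[OF nz]) (use T in \<open>simp add: T_def\<close>)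
  from blk[OF this] have "(\<lambda>x. entrywise \<rho> (\<chi> i. t i (\<Phi> x))) \<in> reach" .
  moreover have "s x $ i = t i (\<Phi> x)" for x i
    using T[of i] unfolding T_def by (blast dest: fun_cong)
  then have "(\<chi> i. t i (\<Phi> x)) = s x" for x
    by (simp add: vec_eq_iff)
  ultimately show ?thesis by simp
qed

text \<open>The coordinate \<open>k\<^sub>0\<close> holds the non-zero constant \<open>\<rho> b\<^sub>0\<close>, which supplies the biases that
  parallel blocks lack. The other coordinates hold \<open>f\<close> through the chart \<open>t \<mapsto> \<rho> (c + e * t)\<close>,
  which is undone by the difference quotient up to an error vanishing with \<open>e\<close>.\<close>

definition enc :: "real \<Rightarrow> ('a \<Rightarrow> real ^ 'k) \<Rightarrow> 'a \<Rightarrow> real ^ 'k" where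
  "enc e f x = entrywise \<rho> (\<chi> i. if i = k\<^sub>0 then b\<^sub>0 else c + e * f x $ i)"

text \<open>Every scale is demanded so that the next layer can let \<open>e\<close> tend to 0 when
  reading. Slot \<open>k\<^sub>0\<close> is normalised to 0 because \<open>enc\<close> overwrites
  it.\<close>

definition good :: "('a \<Rightarrow> real ^ 'k) \<Rightarrow> bool" where
  "good f \<longleftrightarrow> continuous_on K f \<and> (\<forall>x. f x $ k\<^sub>0 = 0) \<and> (\<forall>e>0. enc e f \<in> reach)"

lemma uniform_limit_enc:
  assumes "uniform_limit K s f F" and "continuous_on K f"
  shows "uniform_limit K (\<lambda>n. enc e (s n)) (enc e f) F"
proof -
  have "continuous_on UNIV (\<lambda>y. if i = k\<^sub>0 then b\<^sub>0 else c + e * y $ i)"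
    for i and y :: "real ^ 'k"
    by (cases "i = k\<^sub>0") (auto intro!: continuous_intros)
  then have "continuous_on UNIV (\<lambda>y. entrywise \<rho> (\<chi> i. if i = k\<^sub>0 then b\<^sub>0 else c + e * y $ i))"
    by (intro continuous_on_entrywise[OF cont] continuous_on_vec_lambda)
  from uniform_limit_continuous_compose[OF assms(1) bounded_image[OF assms(2)] this]
  show ?thesis by (simp add: enc_def[abs_def])
qed

text \<open>Two scales are separated: \<open>e\<close> reads the old state and tends to 0,
  \<open>e'\<close> writes the new one and is fixed. The chart \<open>c + e' * t\<close> costs
  nothing, as shallow networks absorb scalings and constants.\<close>

lemma enc_reach_limit:
  assumes blk: "\<And>e B. e > 0 \<Longrightarrow> parallel_dlor_block R \<rho> c B \<Longrightarrow> (\<lambda>x. B (\<Phi> e x)) \<in> reach"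
    and G: "\<And>i e. e > 0 \<Longrightarrow> G i e \<in> shallow \<rho> (range (\<lambda>v x. v \<bullet> \<Phi> e x + c))"
    and lim: "\<And>i. uniform_limit K (G i) (\<lambda>x. s x $ i) (at_right (0::real))"
    and s: "continuous_on K s"
  shows "enc e' s \<in> reach"
proof -
  have "uniform_limit K (\<lambda>e x. \<chi> i. G i e x) s (at_right 0)"
    by (intro uniform_limit_vec) (simp add: lim)
  from uniform_limit_enc[OF this s]
  have lim': "uniform_limit K (\<lambda>e. enc e' (\<lambda>x. \<chi> i. G i e x)) (enc e' s) (at_right 0)" .
  have mem: "enc e' (\<lambda>x. \<chi> i. G i e x) \<in> reach" if "e > 0" for e
    unfolding enc_def
  proof (rule reach_layer[OF blk[OF that]])
    fix i
    show "(\<lambda>x. (\<chi> i. if i = k\<^sub>0 then b\<^sub>0 else c + e' * (\<chi> i. G i e x) $ i) $ i)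
        \<in> shallow \<rho> (range (\<lambda>v x. v \<bullet> \<Phi> e x + c))"
      using shallow_add[OF shallow.const[of c] shallow_scale[OF G[OF that, of i], of e']]
      by (cases "i = k\<^sub>0") (simp_all add: shallow.const)
  qed
  have "\<forall>\<^sub>F e in at_right 0. enc e' (\<lambda>x. \<chi> i. G i e x) \<in> reach"
    using eventually_at_right_less by (rule eventually_mono) (rule mem)
  with lim' show ?thesis
    by (rule uclosure_limit) simp
qed

lemma uniform_limit_difference_quotient_compose:
  fixes g :: "'a \<Rightarrow> real"
  assumes "continuous_on K g"
  shows "uniform_limit K (\<lambda>e x. difference_quotient \<rho> c e (g x)) g (at_right 0)"
proof -
  obtain M where M: "\<And>x. x \<in> K \<Longrightarrow> \<bar>g x\<bar> \<le> M"
    using bounded_image[OF assms] unfolding bounded_iff by auto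
  have "g \<in> K \<rightarrow> {-M..M}" using M by (force simp: abs_le_iff)
  from uniform_limit_compose'[OF uniform_limit_difference_quotient[OF diff nz] this]
  show ?thesis .
qed

text \<open>No constant coordinate exists yet, but the built-in bias \<open>c\<close> suffices: one
  unit with weight \<open>e\<close> on coordinate \<open>i\<close> computes
  \<open>\<rho> (c + e * p x $ i)\<close>, and the rest of the difference quotient is an output
  weight and bias.\<close>

lemma good_input: "good p"
  unfolding good_def
proof (intro conjI allI impI)
  fix e' :: real assume "e' > 0"
  define G where "G i e = (\<lambda>x. difference_quotient \<rho> c e (p x $ i))" for i e
  show "enc e' p \<in> reach"
  proof (rule enc_reach_limit)
    show "(\<lambda>x. B (p x)) \<in> reach" if "parallel_dlor_block R \<rho> c B" for B
      using block_input[OF that] by (rule subset_uclosure)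
    show "G i e \<in> shallow \<rho> (range (\<lambda>v x. v \<bullet> p x + c))" for i e
    proof -
      have "(\<lambda>x. 1 / (e * deriv \<rho> c) * \<rho> ((e *\<^sub>R axis i 1) \<bullet> p x + c) + - \<rho> c / (e * deriv \<rho> c))
          \<in> shallow \<rho> (range (\<lambda>v x. v \<bullet> p x + c))"
        by (intro shallow.intros rangeI)
      then show ?thesis
        by (simp add: G_def difference_quotient_def inner_axis' add.commute diff_divide_distrib)
    qed
    show "uniform_limit K (G i) (\<lambda>x. p x $ i) (at_right 0)" for i
      unfolding G_def
      by (intro uniform_limit_difference_quotient_compose continuous_on_component p)
  qed (rule p)
qed (use p p_k\<^sub>0 in auto)

text \<open>The bias \<open>d\<close> is free here, in contrast to the forms with bias
  \<open>c\<close> that a block offers.\<close>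

definition affine_forms :: "('a \<Rightarrow> real ^ 'k) \<Rightarrow> ('a \<Rightarrow> real) set" where
  "affine_forms f = {g. \<exists>v d. g = (\<lambda>x. v \<bullet> f x + d)}"

text \<open>A form with bias \<open>c\<close> in the encoded state reproduces exactly any affine
  form in the difference quotients of \<open>f\<close>, and these converge to
  \<open>f\<close>.\<close>

lemma shallow_enc_approx:
  assumes f: "good f" and "g \<in> shallow \<rho> (affine_forms f)"
  shows "\<exists>G. (\<forall>e>0. G e \<in> shallow \<rho> (range (\<lambda>v x. v \<bullet> enc e f x + c))) \<and>
    uniform_limit K G g (at_right 0)"
  using assms(2)
proof induction
  case (const b)
  show ?case
    by (intro exI[of _ "\<lambda>e x. b"] conjI allI impI shallow.const uniform_limit_const)
next
  case (step g' g a)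
  then obtain G where G: "\<And>e. e > 0 \<Longrightarrow> G e \<in> shallow \<rho> (range (\<lambda>v x. v \<bullet> enc e f x + c))"
    "uniform_limit K G g (at_right 0)" by blast
  obtain v d where g': "g' = (\<lambda>x. v \<bullet> f x + d)"
    using step.hyps(1) unfolding affine_forms_def by blast
  have contf: "continuous_on K f" and f0: "\<And>x. f x $ k\<^sub>0 = 0"
    using f by (auto simp: good_def)
  define E where "E e x = (\<chi> i. if i = k\<^sub>0 then 0 else difference_quotient \<rho> c e (f x $ i))" for e x
  have "uniform_limit K (\<lambda>e x. E e x $ i) (\<lambda>x. f x $ i) (at_right 0)" for i
    using uniform_limit_difference_quotient_compose[OF continuous_on_component[OF contf], of i]
    by (cases "i = k\<^sub>0") (simp_all add: E_def f0 uniform_limit_const)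
  then have "uniform_limit K E f (at_right 0)" by (rule uniform_limit_vec)
  then have "uniform_limit K (\<lambda>e x. v \<bullet> E e x + d) g' (at_right 0)"
    unfolding g'
    by (intro uniform_limit_add bounded_linear.uniform_limit[OF bounded_linear_inner_right]
        uniform_limit_const)
  moreover have contg': "continuous_on K g'"
    unfolding g' by (intro continuous_intros contf)
  ultimately have "uniform_limit K (\<lambda>e x. \<rho> (v \<bullet> E e x + d)) (\<lambda>x. \<rho> (g' x)) (at_right 0)"
    using uniform_limit_continuous_compose bounded_image cont by blast
  then have "uniform_limit K (\<lambda>e x. a * \<rho> (v \<bullet> E e x + d) + G e x) (\<lambda>x. a * \<rho> (g' x) + g x) (at_right 0)"
    by (intro uniform_limit_add bounded_linear.uniform_limit[OF bounded_linear_mult_right] G(2))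
  moreover have "(\<lambda>x. a * \<rho> (v \<bullet> E e x + d) + G e x) \<in> shallow \<rho> (range (\<lambda>v x. v \<bullet> enc e f x + c))"
    if "e > 0" for e
  proof -
    define m where "m = e * deriv \<rho> c"
    \<comment> \<open>The weight on \<open>k\<^sub>0\<close>, multiplied by the stored
      \<open>\<rho> b\<^sub>0\<close>, replaces the bias \<open>c\<close> by \<open>d\<close> and
      cancels the offsets \<open>\<rho> c / m\<close> of the difference quotients.\<close>
    define w where "w = (\<chi> i. if i = k\<^sub>0 then (d - c - (\<Sum>j\<in>-{k\<^sub>0}. v $ j * \<rho> c / m)) / \<rho> b\<^sub>0
      else v $ i / m)"
    have "w \<bullet> enc e f x + c = v \<bullet> E e x + d" for x
    proof -
      have split: "(\<Sum>i\<in>UNIV. t i) = t k\<^sub>0 + (\<Sum>i\<in>-{k\<^sub>0}. t i)" for t :: "'k \<Rightarrow> real"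
        by (subst sum.remove[of UNIV k\<^sub>0]) (auto simp: Compl_eq_Diff_UNIV)
      have "w \<bullet> enc e f x = (d - c - (\<Sum>j\<in>-{k\<^sub>0}. v $ j * \<rho> c / m)) +
          (\<Sum>i\<in>-{k\<^sub>0}. v $ i / m * \<rho> (c + e * f x $ i))"
        unfolding inner_vec_def split using b\<^sub>0 by (simp add: w_def enc_def entrywise_def)
      also have "(\<Sum>i\<in>-{k\<^sub>0}. v $ i / m * \<rho> (c + e * f x $ i)) =
          (\<Sum>i\<in>-{k\<^sub>0}. v $ i * \<rho> c / m) +
          (\<Sum>i\<in>-{k\<^sub>0}. v $ i * difference_quotient \<rho> c e (f x $ i))"
        unfolding sum.distrib[symmetric]
        by (intro sum.cong refl)
          (simp add: difference_quotient_def m_def diff_divide_distrib right_diff_distrib)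
      also have "(\<Sum>i\<in>-{k\<^sub>0}. v $ i * difference_quotient \<rho> c e (f x $ i)) = v \<bullet> E e x"
        unfolding inner_vec_def split by (simp add: E_def)
      finally show ?thesis by simp
    qed
    then have "(\<lambda>x. a * \<rho> (v \<bullet> E e x + d) + G e x) = (\<lambda>x. a * \<rho> (w \<bullet> enc e f x + c) + G e x)"
      by simp
    then show ?thesis
      using shallow.step[OF rangeI[of "\<lambda>v x. v \<bullet> enc e f x + c" w] G(1)[OF that], of a] by simp
  qed
  ultimately show ?case
    by (intro exI[of _ "\<lambda>e x. a * \<rho> (v \<bullet> E e x + d) + G e x"] conjI allI impI)
qed

lemma continuous_on_ushallow_good:
  assumes "good f" and "g \<in> ushallow \<rho> K (affine_forms f)"
  shows "continuous_on K g"
proof (rule uclosure_continuous_on[OF assms(2)])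
  fix s assume "s \<in> shallow \<rho> (affine_forms f)"
  then show "continuous_on K s"
    using assms(1) by (rule_tac shallow_continuous_on[OF _ cont])
      (auto simp: affine_forms_def good_def intro!: continuous_intros)
qed

text \<open>Limits are taken in two rounds at a fixed writing scale: exactly shallow updates are
  reached by letting the reading scale vanish, then \<open>f'\<close> is a uniform limit of such
  updates.\<close>

lemma good_step:
  assumes f: "good f" and f': "\<And>i. (\<lambda>x. f' x $ i) \<in> ushallow \<rho> K (affine_forms f)"
    and f'0: "\<And>x. f' x $ k\<^sub>0 = 0"
  shows "good f'"
proof -
  have "continuous_on K (\<lambda>x. \<chi> i. f' x $ i)"
    by (intro continuous_on_vec_lambda continuous_on_ushallow_good[OF f] f')
  then have contf': "continuous_on K f'" by simp
  have exact: "enc e' s \<in> reach" if s: "\<And>i. (\<lambda>x. s x $ i) \<in> shallow \<rho> (affine_forms f)" for e' s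
  proof -
    define A where "A i G \<longleftrightarrow> (\<forall>e>0. G e \<in> shallow \<rho> (range (\<lambda>v x. v \<bullet> enc e f x + c))) \<and>
      uniform_limit K G (\<lambda>x. s x $ i) (at_right 0)" for i G
    have "\<forall>i. \<exists>G. A i G" using shallow_enc_approx[OF f s] unfolding A_def by blast
    then obtain G where G: "\<And>i. A i (G i)" by metis
    have "continuous_on K (\<lambda>x. \<chi> i. s x $ i)"
      by (intro continuous_on_vec_lambda continuous_on_ushallow_good[OF f] subset_uclosure s)
    then have conts: "continuous_on K s" by simp
    show ?thesis
    proof (rule enc_reach_limit[where \<Phi> = "\<lambda>e. enc e f" and G = G])
      show "(\<lambda>x. B (enc e f x)) \<in> reach" if "e > 0" "parallel_dlor_block R \<rho> c B" for e B
        using reach_block that f by (simp add: good_def)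
    qed (use G conts in \<open>simp_all add: A_def\<close>)
  qed
  have "f' \<in> uclosure K {s. \<forall>i. (\<lambda>x. s x $ i) \<in> shallow \<rho> (affine_forms f)}"
    by (rule uclosure_vec[OF f'])
  then obtain s where s: "\<And>n::nat. s n \<in> {s. \<forall>i. (\<lambda>x. s x $ i) \<in> shallow \<rho> (affine_forms f)}"
    "uniform_limit K s f' sequentially"
    using uclosure_sequence by blast
  have "enc e' (s n) \<in> reach" for e' n
    using s(1)[of n] by (intro exact) simp
  then have "enc e' f' \<in> reach" for e'
    by (intro uclosure_limit[OF uniform_limit_enc[OF s(2) contf']]) simp_all
  with contf' f'0 show ?thesis by (simp add: good_def)
qed

section \<open>Squares, copies and products of stored coordinates\<close>

lemma ushallow_good_square:
  assumes "good f"
  shows "(\<lambda>x. (v \<bullet> f x + d) ^ 2) \<in> ushallow \<rho> K (affine_forms f)"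
proof -
  have "continuous_on K (\<lambda>x. v \<bullet> f x + d)"
    using assms by (auto simp: good_def intro!: continuous_intros)
  from bounded_image[OF this] obtain M where "\<And>x. x \<in> K \<Longrightarrow> \<bar>v \<bullet> f x + d\<bar> \<le> M"
    unfolding bounded_iff by auto
  then have "(\<lambda>x. v \<bullet> f x + d) ` K \<subseteq> {-M..M}"
    by (force simp: abs_le_iff)
  then show ?thesis
  proof (rule uclosure_compose[OF ushallow_square[OF cont not_affine]])
    fix s assume "s \<in> shallow \<rho> affs"
    then show "(\<lambda>x. s (v \<bullet> f x + d)) \<in> shallow \<rho> (affine_forms f)"
    proof (rule shallow_compose)
      fix g assume "g \<in> affs"
      then obtain w e where "g = (\<lambda>x. w * x + e)" by blast
      then have "(\<lambda>x. g (v \<bullet> f x + d)) = (\<lambda>x. (w *\<^sub>R v) \<bullet> f x + (w * d + e))"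
        by (simp add: fun_eq_iff algebra_simps)
      then show "(\<lambda>x. g (v \<bullet> f x + d)) \<in> affine_forms f"
        unfolding affine_forms_def by blast
    qed
  qed
qed

text \<open>Even copying passes through \<open>\<rho>\<close>; the linear term is recovered from
  \<open>((t + 1)^2 - t^2 - 1) / 2 = t\<close>.\<close>

lemma ushallow_good_component:
  assumes "good f"
  shows "(\<lambda>x. f x $ i) \<in> ushallow \<rho> K (affine_forms f)"
proof -
  have "(\<lambda>x. 1/2 * (axis i 1 \<bullet> f x + 1) ^ 2 + (-1/2 * (axis i 1 \<bullet> f x + 0) ^ 2 + -1/2))
      \<in> ushallow \<rho> K (affine_forms f)"
    by (intro ushallow_add[OF ushallow_scale ushallow_add[OF ushallow_scale ushallow_const]]
        ushallow_good_square assms)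
  moreover have "1/2 * (t + 1) ^ 2 + (-1/2 * (t + 0) ^ 2 + -1/2) = t" for t :: real
    by (simp add: power2_eq_square field_simps)
  ultimately show ?thesis by (simp add: inner_axis')
qed

text \<open>Polarisation: \<open>(s + t)^2 - (s - t)^2 = 4 * s * t\<close>.\<close>

lemma ushallow_good_mult:
  assumes "good f"
  shows "(\<lambda>x. f x $ i * f x $ j) \<in> ushallow \<rho> K (affine_forms f)"
proof -
  have "(\<lambda>x. 1/4 * ((axis i 1 + axis j 1) \<bullet> f x + 0) ^ 2 +
      -1/4 * ((axis i 1 - axis j 1) \<bullet> f x + 0) ^ 2) \<in> ushallow \<rho> K (affine_forms f)"
    by (intro ushallow_add[OF ushallow_scale ushallow_scale] ushallow_good_square assms)
  moreover have "1/4 * (s + t + 0) ^ 2 + -1/4 * (s - t + 0) ^ 2 = s * t" for s t :: real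
    by (simp add: power2_eq_square field_simps)
  ultimately show ?thesis by (simp add: inner_axis' inner_add_left inner_diff_left)
qed

section \<open>Linear readout\<close>

definition outputs :: "('a \<Rightarrow> real ^ 'm) set" where
  "outputs = {g. \<exists>s\<in>nets. \<exists>A a. g = (\<lambda>x. A *v s x + a)}"

lemma continuous_on_matrix_affine:
  fixes A :: "real ^ 'k ^ 'm"
  assumes "continuous_on S f"
  shows "continuous_on S (\<lambda>x. A *v f x + a)"
  by (intro continuous_intros assms
      bounded_linear.continuous_on[OF matrix_vector_mul_bounded_linear])

lemma continuous_on_outputs: "g \<in> outputs \<Longrightarrow> continuous_on K g"
  unfolding outputs_def by (auto intro: continuous_on_matrix_affine continuous_on_nets)

text \<open>The output layer is affine, as is the difference quotient in the stored value, so it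
  decodes all selected coordinates; the error vanishes with \<open>e\<close>.\<close>

lemma good_readout:
  fixes \<pi> :: "'m::finite \<Rightarrow> 'k"
  assumes f: "good f" and \<pi>: "\<And>j. \<pi> j \<noteq> k\<^sub>0"
  shows "(\<lambda>x. \<chi> j. f x $ \<pi> j) \<in> uclosure K outputs"
proof -
  define A :: "real \<Rightarrow> real ^ 'k ^ 'm"
    where "A e = (\<chi> j i. if i = \<pi> j then 1 / (e * deriv \<rho> c) else 0)" for e
  define a :: "real \<Rightarrow> real ^ 'm" where "a e = (\<chi> j. - \<rho> c / (e * deriv \<rho> c))" for e
  have comp: "(A e *v enc e f x + a e) $ j = difference_quotient \<rho> c e (f x $ \<pi> j)" for e x j
    using \<pi>[of j]
    by (simp add: A_def a_def matrix_vector_mult_def enc_def entrywise_def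
        difference_quotient_def diff_divide_distrib if_distrib[of "\<lambda>t. t * _"] cong: if_cong)
  have "continuous_on K (\<lambda>x. f x $ \<pi> j)" for j
    using f by (auto simp: good_def intro!: continuous_intros)
  then have lim: "uniform_limit K (\<lambda>e x. A e *v enc e f x + a e) (\<lambda>x. \<chi> j. f x $ \<pi> j) (at_right 0)"
    by (intro uniform_limit_vec) (simp only: comp vec_lambda_beta uniform_limit_difference_quotient_compose)
  have mem: "(\<lambda>x. A e *v enc e f x + a e) \<in> uclosure K outputs" if "e > 0" for e
  proof -
    have enc: "enc e f \<in> reach" using f that by (simp add: good_def)
    then obtain s where s: "\<And>n::nat. s n \<in> nets" "uniform_limit K s (enc e f) sequentially"
      using uclosure_sequence by blast
    have lim: "uniform_limit K (\<lambda>n x. A e *v s n x + a e) (\<lambda>x. A e *v enc e f x + a e) sequentially"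
      by (rule uniform_limit_continuous_compose[OF s(2) bounded_image[OF continuous_on_reach[OF enc]]
            continuous_on_matrix_affine[OF continuous_on_id]])
    have "(\<lambda>x. A e *v s n x + a e) \<in> outputs" for n
      using s(1) unfolding outputs_def by blast
    then show ?thesis
      by (intro uclosure_limit[OF lim]) (simp_all add: subset_uclosure)
  qed
  have "\<forall>\<^sub>F e in at_right 0. (\<lambda>x. A e *v enc e f x + a e) \<in> uclosure K outputs"
    using eventually_at_right_less by (rule eventually_mono) (rule mem)
  with lim show ?thesis
    by (rule uclosure_limit) simp
qed

end

section \<open>Evaluating polynomials in registers\<close>

text \<open>Monomials grow by one variable at a time, just as the working register is multiplied in
  place by an input coordinate.\<close>

inductive_set monomials :: "(real ^ 'n \<Rightarrow> real) set" where
  one: "(\<lambda>x. 1) \<in> monomials"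
| var: "g \<in> monomials \<Longrightarrow> (\<lambda>x. x $ i * g x) \<in> monomials"

abbreviation polynomials :: "(real ^ 'n \<Rightarrow> real) set" where
  "polynomials \<equiv> shallow (\<lambda>t. t) monomials"

lemma monomials_mult:
  assumes "g \<in> monomials" and "g' \<in> monomials"
  shows "(\<lambda>x. g x * g' x) \<in> monomials"
  using assms(1)
proof induction
  case one
  show ?case using assms(2) by simp
next
  case (var g i)
  from monomials.var[OF var.IH, of i] show ?case by (simp add: mult.assoc)
qed

lemma polynomials_monomial_mult:
  assumes "m \<in> monomials" and "g \<in> polynomials"
  shows "(\<lambda>x. m x * g x) \<in> polynomials"
  using assms(2)
proof induction
  case (const b)
  from shallow.step[OF assms(1) shallow.const[of 0], of b] show ?case by (simp add: mult.commute)
next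
  case (step f g a)
  from shallow.step[OF monomials_mult[OF assms(1) step.hyps(1)] step.IH, of a]
  show ?case by (simp add: algebra_simps)
qed

lemma polynomials_mult:
  assumes "g \<in> polynomials" and "g' \<in> polynomials"
  shows "(\<lambda>x. g x * g' x) \<in> polynomials"
  using assms(1)
proof induction
  case (const b)
  show ?case using shallow_scale[OF assms(2)] .
next
  case (step f g a)
  from shallow_add[OF shallow_scale[OF polynomials_monomial_mult[OF step.hyps(1) assms(2)], of a] step.IH]
  show ?case by (simp add: algebra_simps)
qed

lemma continuous_on_polynomials:
  fixes g :: "real ^ 'n \<Rightarrow> real"
  assumes "g \<in> polynomials"
  shows "continuous_on S g"
proof (rule shallow_continuous_on[OF assms])
  fix m :: "real ^ 'n \<Rightarrow> real" assume "m \<in> monomials"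
  then show "continuous_on S m" by induction (auto intro!: continuous_intros)
qed (rule continuous_on_id)

lemma uclosure_polynomials:
  fixes f :: "real ^ 'n \<Rightarrow> real"
  assumes "compact K" and "continuous_on K f"
  shows "f \<in> uclosure K polynomials"
proof (rule uclosureI)
  fix e :: real assume "e > 0"
  have "\<exists>g. g \<in> polynomials \<and> (\<forall>x\<in>K. \<bar>f x - g x\<bar> < e)"
  proof (rule Stone_Weierstrass_HOL[OF assms(1)])
    show "(\<lambda>x. b) \<in> polynomials" for b by (rule shallow.const)
    show "continuous_on K g" if "g \<in> polynomials" for g
      using that by (rule continuous_on_polynomials)
    show "(\<lambda>x. g x + g' x) \<in> polynomials" if "g \<in> polynomials \<and> g' \<in> polynomials" for g g'
      using that by (blast intro: shallow_add)
    show "(\<lambda>x. g x * g' x) \<in> polynomials" if "g \<in> polynomials \<and> g' \<in> polynomials" for g g'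
      using that by (blast intro: polynomials_mult)
    show "\<exists>g. g \<in> polynomials \<and> g x \<noteq> g y" if "x \<in> K \<and> y \<in> K \<and> x \<noteq> y" for x y
    proof -
      obtain i where "x $ i \<noteq> y $ i" using \<open>x \<in> K \<and> y \<in> K \<and> x \<noteq> y\<close> by (auto simp: vec_eq_iff)
      moreover have "(\<lambda>x. x $ i * 1) \<in> polynomials"
        by (intro shallow_unit[of _ _ "\<lambda>t. t"] monomials.intros)
      ultimately show ?thesis
        by (intro exI[of _ "\<lambda>x. x $ i * 1"] conjI) simp_all
    qed
  qed (use assms(2) \<open>e > 0\<close> in auto)
  then show "\<exists>s\<in>polynomials. \<forall>x\<in>K. dist (s x) (f x) < e"
    by (auto simp: dist_real_def abs_minus_commute)
qed

text \<open>Of the two elements of type \<open>2\<close>, index 0 is the slot for the constant,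
  empty here because \<open>enc\<close> fills it, and index 1 is the working register.\<close>

definition registers ::
  "('m::finite \<Rightarrow> real ^ 'n::finite \<Rightarrow> real) \<Rightarrow> (real ^ 'n \<Rightarrow> real) \<Rightarrow> real ^ 'n \<Rightarrow> real ^ ('n + 'm + 2)" where
  "registers q w x = (\<chi> i. case i of Inl j \<Rightarrow> x $ j
     | Inr i \<Rightarrow> (case i of Inl j \<Rightarrow> q j x | Inr t \<Rightarrow> if t = 0 then 0 else w x))"

lemma registers_simps [simp]:
  "registers q w x $ Inl i = x $ i"
  "registers q w x $ Inr (Inl j) = q j x"
  "registers q w x $ Inr (Inr 0) = 0"
  "registers q w x $ Inr (Inr 1) = w x"
  by (simp_all add: registers_def)

locale dlor_registers =
  dlor_states R \<rho> c b\<^sub>0 K "zero_pad :: real ^ 'n::finite \<Rightarrow> real ^ ('n + 'm::finite + 2)" "Inr (Inr 0)"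
  for R :: "'r::finite itself" and \<rho> c b\<^sub>0 and K :: "(real ^ 'n::finite) set" +
  fixes Q :: "'m::finite itself"
begin

lemma registers_step:
  fixes q q' :: "'m \<Rightarrow> real ^ 'n \<Rightarrow> real"
  assumes good: "good (registers q w)"
    and q': "\<And>j. q' j \<in> ushallow \<rho> K (affine_forms (registers q w))"
    and w': "w' \<in> ushallow \<rho> K (affine_forms (registers q w))"
  shows "good (registers q' w')"
proof (rule good_step[OF good])
  fix i :: "'n + 'm + 2"
  show "(\<lambda>x. registers q' w' x $ i) \<in> ushallow \<rho> K (affine_forms (registers q w))"
  proof (cases i)
    case (Inl a)
    then show ?thesis using ushallow_good_component[OF good, of "Inl a"] by simp
  next
    case (Inr i')
    then show ?thesis
    proof (cases i')
      case (Inr t)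
      with \<open>i = Inr i'\<close> show ?thesis
        using w' by (cases "t = 0") (simp_all add: registers_def ushallow_const)
    qed (use q' in simp)
  qed
qed simp

lemma registers_input: "good (registers (\<lambda>j :: 'm. \<lambda>x. 0) (\<lambda>x. 0))"
proof -
  have "registers (\<lambda>j :: 'm. \<lambda>x. 0) (\<lambda>x. 0) = (zero_pad :: real ^ 'n \<Rightarrow> _)"
    by (auto simp: registers_def zero_pad_def fun_eq_iff vec_eq_iff split: sum.split)
  then show ?thesis using good_input by simp
qed

lemma registers_output_mem:
  fixes q :: "'m \<Rightarrow> real ^ 'n \<Rightarrow> real"
  assumes "good (registers q w)"
  shows "q j \<in> ushallow \<rho> K (affine_forms (registers q w))"
  using ushallow_good_component[OF assms, of "Inr (Inl j)"] by simp

lemma registers_work_mem: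
  fixes q :: "'m \<Rightarrow> real ^ 'n \<Rightarrow> real"
  assumes "good (registers q w)"
  shows "w \<in> ushallow \<rho> K (affine_forms (registers q w))"
  using ushallow_good_component[OF assms, of "Inr (Inr 1)"] by simp

text \<open>A block reads the whole old state before writing, so one register suffices: it is reset
  to 1, whatever \<open>w\<close> was, and then multiplied by one input per block.\<close>

lemma registers_monomial:
  fixes q :: "'m \<Rightarrow> real ^ 'n \<Rightarrow> real"
  assumes "m \<in> monomials" and good: "good (registers q w)"
  shows "good (registers q m)"
  using assms(1)
proof induction
  case one
  show ?case
    by (rule registers_step[OF good registers_output_mem[OF good] ushallow_const])
next
  case (var m i)
  show ?case
    using ushallow_good_mult[OF var.IH, of "Inl i" "Inr (Inr 1)"]
    by (intro registers_step[OF var.IH registers_output_mem[OF var.IH]]) simp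
qed

text \<open>Each term is built in the working register and added to accumulator \<open>j\<close>.
  The leftover content is unspecified, hence the existential \<open>w'\<close> and the induction
  over arbitrary \<open>q\<close> and \<open>w\<close>.\<close>

lemma registers_add_polynomial:
  fixes q :: "'m \<Rightarrow> real ^ 'n \<Rightarrow> real"
  assumes "g \<in> polynomials" and "good (registers q w)"
  shows "\<exists>w'. good (registers (q(j := \<lambda>x. q j x + g x)) w')"
  using assms
proof (induction arbitrary: q w)
  case (const b)
  define q' where "q' = q(j := \<lambda>x. q j x + b)"
  have q': "q' i \<in> ushallow \<rho> K (affine_forms (registers q w))" for i
    using registers_output_mem[OF const, of i]
      ushallow_add[OF registers_output_mem[OF const, of j] ushallow_const[of b]]
    by (auto simp: q'_def)
  have "good (registers q' w)"
    by (rule registers_step[OF const q' registers_work_mem[OF const]])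
  then show ?case unfolding q'_def by blast
next
  case (step m g a)
  have good: "good (registers q m)"
    by (rule registers_monomial[OF step.hyps(1) step.prems])
  define q' where "q' = q(j := \<lambda>x. q j x + a * m x)"
  have "q' i \<in> ushallow \<rho> K (affine_forms (registers q m))" for i
    using registers_output_mem[OF good, of i]
      ushallow_add[OF registers_output_mem[OF good, of j] ushallow_scale[OF registers_work_mem[OF good], of a]]
    by (auto simp: q'_def)
  then have "good (registers q' m)"
    by (rule registers_step[OF good _ registers_work_mem[OF good]])
  from step.IH[OF this] have "\<exists>w'. good (registers (q'(j := \<lambda>x. q' j x + g x)) w')" .
  moreover have "q'(j := \<lambda>x. q' j x + g x) = q(j := \<lambda>x. q j x + (a * m x + g x))"
    by (simp add: q'_def add.assoc)
  ultimately show ?case by (simp only:)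
qed

lemma registers_polynomials:
  fixes g :: "'m \<Rightarrow> real ^ 'n \<Rightarrow> real"
  assumes "\<And>j. g j \<in> polynomials"
  shows "\<exists>w. good (registers g w)"
proof -
  \<comment> \<open>Accumulators in \<open>J\<close> are finished, the others still hold the 0 of
    the padded input.\<close>
  have "\<exists>w. good (registers (\<lambda>j. if j \<in> J then g j else (\<lambda>x. 0)) w)" if "finite J" for J
    using that
  proof (induction J rule: finite_induct)
    case empty
    show ?case using registers_input by auto
  next
    case (insert j J)
    then obtain w where "good (registers (\<lambda>j. if j \<in> J then g j else (\<lambda>x. 0)) w)" by blast
    from registers_add_polynomial[OF assms[of j] this, of j] insert.hyps(2)
    have "\<exists>w. good (registers ((\<lambda>j. if j \<in> J then g j else (\<lambda>x. 0))(j := g j)) w)"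
      by simp
    moreover have "(\<lambda>j. if j \<in> J then g j else (\<lambda>x. 0))(j := g j) =
      (\<lambda>i. if i \<in> insert j J then g i else (\<lambda>x. 0))"
      by (auto simp: fun_eq_iff)
    ultimately show ?case by simp
  qed
  from this[of UNIV] show ?thesis by simp
qed

lemma uclosure_outputs:
  fixes f :: "real ^ 'n \<Rightarrow> real ^ 'm"
  assumes "continuous_on K f"
  shows "f \<in> uclosure K outputs"
proof (rule uclosure_trans)
  show "f \<in> uclosure K {s. \<forall>j. (\<lambda>x. s x $ j) \<in> polynomials}"
    by (intro uclosure_vec uclosure_polynomials K continuous_on_component assms)
  fix s :: "real ^ 'n \<Rightarrow> real ^ 'm" assume "s \<in> {s. \<forall>j. (\<lambda>x. s x $ j) \<in> polynomials}"
  then obtain w where "good (registers (\<lambda>j x. s x $ j) w)"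
    using registers_polynomials[of "\<lambda>j x. s x $ j"] by auto
  from good_readout[OF this, of "\<lambda>j. Inr (Inl j)"] show "s \<in> uclosure K outputs"
    by simp
qed

end

section \<open>Density in the metric space of continuous functions\<close>

lemma closure_of_cfunspace_eq_mspace:
  fixes K :: "'a::metric_space set" and S :: "('a \<Rightarrow> 'b::metric_space) set"
  assumes "compact K" and cont: "\<And>g. g \<in> S \<Longrightarrow> continuous_on K g"
    and dense: "\<And>f. continuous_on K f \<Longrightarrow> f \<in> uclosure K S"
  shows "mtopology_of (cfunspace (top_of_set K) euclidean_metric) closure_of {restrict g K | g. g \<in> S} =
    mspace (cfunspace (top_of_set K) euclidean_metric)" (is "mtopology_of ?C closure_of _ = _")
proof -
  have mspace: "mspace ?C = {f. f \<in> extensional K \<and> continuous_on K f}"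
    using assms(1)
    by (auto intro: compact_imp_bounded compact_continuous_image)
  have "\<exists>y\<in>{restrict g K | g. g \<in> S}. y \<in> mspace ?C \<and> mdist ?C f y < r"
    if f: "f \<in> mspace ?C" and "r > 0" for f r
  proof -
    have "continuous_on K f" using f by (simp add: mspace)
    \<comment> \<open>Pointwise strict bounds give only a weak bound on the supremum distance, so
      half the radius is used.\<close>
    from uclosureD[OF dense[OF this], of "r / 2"] \<open>r > 0\<close> obtain g
      where g: "g \<in> S" "\<And>x. x \<in> K \<Longrightarrow> dist (g x) (f x) < r / 2" by auto
    have "mdist ?C f (restrict g K) \<le> r / 2"
      using g(2) \<open>r > 0\<close> by (intro mdist_cfunspace_le) (auto simp: dist_commute less_imp_le)
    then have "mdist ?C f (restrict g K) < r" using \<open>r > 0\<close> by simp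
    moreover have "restrict g K \<in> mspace ?C"
      unfolding mspace using cont[OF g(1)] by (simp cong: continuous_on_cong)
    ultimately show ?thesis using g(1) by blast
  qed
  then show ?thesis
    unfolding mtopology_of_def Metric_space.metric_closure_of[OF Metric_space_mspace_mdist]
      Metric_space.in_mball[OF Metric_space_mspace_mdist]
    by blast
qed

theorem theorem6:
  fixes \<rho> :: "real \<Rightarrow> real" and c :: real and K :: "(real ^ 'n::finite) set"
  assumes "continuous_on UNIV \<rho>" and "\<not> affine_fun \<rho>"
    and "cont_diff_at \<rho> c" and "deriv \<rho> c \<noteq> 0"
    and "compact K"
  shows "mtopology_of (cfunspace (top_of_set K) euclidean_metric) closure_of
           {restrict g K | g :: real ^ 'n \<Rightarrow> real ^ 'm::finite.
              wide_dlor_network TYPE('r::finite) \<rho> c g} =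
         mspace (cfunspace (top_of_set K) euclidean_metric)"
proof -
  have "\<exists>b\<^sub>0. \<rho> b\<^sub>0 \<noteq> 0"
  proof (rule ccontr)
    assume "\<not> (\<exists>b\<^sub>0. \<rho> b\<^sub>0 \<noteq> 0)"
    then have "\<rho> x = 0 * x + 0" for x by simp
    then show False using assms(2) unfolding affine_fun_def by blast
  qed
  then obtain b\<^sub>0 where b\<^sub>0: "\<rho> b\<^sub>0 \<noteq> 0" by blast
  have diff: "\<rho> differentiable (at c)"
    using assms(3) eventually_nhds_x_imp_x unfolding cont_diff_at_def by blast
  have pad: "continuous_on K (zero_pad :: real ^ 'n \<Rightarrow> real ^ ('n + 'm + 2))"
    unfolding zero_pad_def
  proof (rule continuous_on_vec_lambda)
    fix i :: "'n + 'm + 2"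
    show "continuous_on K (\<lambda>x. case i of Inl j \<Rightarrow> x $ j | Inr _ \<Rightarrow> 0)"
      by (cases i) (auto intro!: continuous_intros)
  qed
  interpret dlor_registers "TYPE('r)" \<rho> c b\<^sub>0 K "TYPE('m)"
    by unfold_locales (use assms b\<^sub>0 diff pad in \<open>simp_all add: zero_pad_def\<close>)
  \<comment> \<open>With the register layout fixed, \<open>nets\<close> followed by an affine map is
    literally the network class of the statement.\<close>
  have "wide_dlor_network TYPE('r) \<rho> c g \<longleftrightarrow> g \<in> outputs" for g :: "real ^ 'n \<Rightarrow> real ^ 'm"
  proof
    assume "wide_dlor_network TYPE('r) \<rho> c g"
    then obtain Bs and A :: "real ^ ('n + 'm + 2) ^ 'm" and a where
      "Bs \<noteq> []" "\<forall>B\<in>set Bs. parallel_dlor_block TYPE('r) \<rho> c B"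
      and g: "g = (\<lambda>x. A *v fold (\<lambda>B z. B z) Bs (zero_pad x) + a)"
      unfolding wide_dlor_network_def by blast
    then have "(\<lambda>x. fold (\<lambda>B z. B z) Bs (zero_pad x)) \<in> nets"
      unfolding nets_def by blast
    then show "g \<in> outputs"
      unfolding outputs_def g by (intro CollectI bexI exI) simp_all
  next
    assume "g \<in> outputs"
    then show "wide_dlor_network TYPE('r) \<rho> c g"
      unfolding wide_dlor_network_def outputs_def nets_def by blast
  qed
  then show ?thesis
    using closure_of_cfunspace_eq_mspace[OF assms(5) continuous_on_outputs uclosure_outputs]
    by simp
qed

end
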